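(* Consider a family of linear systems $u'(t)=Lu(t)+g(t)=:F(t,u(t))$, $u(0)=u_0$, in $\mathbb{R}^m$ (semi-discrete systems; $m$, $L$, $g$, $u$ vary with the spatial mesh), with cell-based splitting $F=\sum_{k=1}^rF_k$, $F_k=I_kF$, and apply an explicit $s$-stage partitioned Runge-Kutta method with classical order $p$ and stage order $q$ (see context), with time step $\Delta t>0$ and starting value $u_0=u(0)$. Let $Z_k=\Delta t\,I_kL$, $\underline{Z}=(Z_1,\dots,Z_r)$, and assume, with constants independent of the spatial mesh and of $\Delta t$, that $\|Z_k\|_\infty=\mathcal{O}(1)$ for $k=1,\dots,r$ and that the derivatives of the exact solution satisfy $\|u^{(i)}(t)\|_\infty=\mathcal{O}(1)$. Assume that $p\ge q+1$ and that the stability condition $$\sup_{n\ge0}\|R(\underline{Z})^n\|_\infty\le K$$ holds (with $K$ independent of the mesh and of $\Delta t$). Assume furthermore that there is a matrix $W\in\mathbb{R}^{m\times m}$ such that $$\big(\boldsymbol{r}(\underline{Z})^T\boldsymbol{e}\big)W=\sum_{k=1}^r d_{q+1,k}(\underline{Z})\,I_k$$ with $\|W\|_\infty=\mathcal{O}(1)$ (uniformly in the mesh and $\Delta t$). Then the method is convergent with order $q+1$ in the maximum norm: on any fixed time interval $[0,T]$, the global errors $\varepsilon_n=u(t_n)-u_n$ satisfy $\|\varepsilon_n\|_\infty\le C\,\Delta t^{q+1}$ for all $n$ with $0\le t_n=n\Delta t\le T$ and all sufficiently small $\Delta t$, with $C$ independent of the spatial mesh, of $\Delta t$ and of $n$.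
   Context: The index set $\{1,\dots,m\}$ is partitioned into $\mathcal{I}_1\cup\dots\cup\mathcal{I}_r$ (disjoint), and $I_k\in\mathbb{R}^{m\times m}$ is the diagonal matrix whose $j$-th diagonal entry is $1$ if $j\in\mathcal{I}_k$ and $0$ otherwise, so $I_1+\dots+I_r=I$. $\|\cdot\|_\infty$ is the maximum norm on $\mathbb{R}^m$ and its induced matrix norm. The method (i.e. its coefficients, $r$ and $s$) is fixed over the family, and the exact solution $u$ is smooth on a time interval containing all time points involved (including the stage times). $\mathcal{O}(1)$ denotes quantities bounded by a constant that does not depend on the mesh or on $\Delta t$ (for derivatives: one constant for each order $i\ge 1$, uniformly in $t$). The partitioned Runge-Kutta method is $$v_{n,i}=u_n+\Delta t\sum_{k=1}^r\sum_{j=1}^s a^{(k)}_{ij}F_k(t_n+c_j\Delta t,v_{n,j}),\quad i=1,\dots,s,$$ $$u_{n+1}=u_n+\Delta t\sum_{k=1}^r\sum_{j=1}^s b^{(k)}_jF_k(t_n+c_j\Delta t,v_{n,j}),$$ with $t_n=n\Delta t$, $A_k=[a^{(k)}_{ij}]\in\mathbb{R}^{s\times s}$, $b_k=[b^{(k)}_i]\in\mathbb{R}^s$, $c=[c_i]=A_re$, $e=[1,\dots,1]^T\in\mathbb{R}^s$. Explicit means $a^{(k)}_{ij}=0$ for $j\ge i$. Componentwise powers: $c^j=[c_i^{\,j}]$ for $j\ge 1$, $c^0=e$. Classical order $p$ is the usual (non-stiff) order of consistency of the method for fixed smooth ODEs with arbitrary smooth splittings. The order conditions are: $p\ge1$: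 $b_k^Te=1$ for all $k$; $p\ge2$: in addition $b_k^TA_le=\frac12$ for all $k,l$; $p\ge3$: in addition $b_k^TC_{l_1}A_{l_2}e=\frac13$ and $b_k^TA_{l_1}A_{l_2}e=\frac16$ for all $k,l_1,l_2$, with $C_l=\mathrm{diag}(A_le)$. Stage order $q\ge 0$ means $A_kc^j=\frac1{j+1}c^{j+1}$ for $j=0,\dots,q-1$ and $k=1,\dots,r$ (no condition if $q=0$); explicit methods can only have $q\in\{0,1\}$. Notation: $\boldsymbol{A}_k=A_k\otimes I$, $\boldsymbol{b}_k^T=b_k^T\otimes I$, $\boldsymbol{c}^j=c^j\otimes I$, $\boldsymbol{e}=e\otimes I$ with $I$ the $m\times m$ identity; $\boldsymbol{Z}_k=I_{s\times s}\otimes Z_k$, where $I_{s\times s}$ is the $s\times s$ identity; $\boldsymbol{I}$ is the $ms\times ms$ identity. Define $$\boldsymbol{r}(\underline{Z})^T=\Big(\sum_{k=1}^r\boldsymbol{b}_k^T\boldsymbol{Z}_k\Big)\Big(\boldsymbol{I}-\sum_{k=1}^r\boldsymbol{A}_k\boldsymbol{Z}_k\Big)^{-1}\in\mathbb{R}^{m\times ms},\qquad R(\underline{Z})=I+\boldsymbol{r}(\underline{Z})^T\boldsymbol{e},$$ $$d_{j,k}(\underline{Z})=\big(I-j\,\boldsymbol{b}_k^T\boldsymbol{c}^{j-1}\big)+\boldsymbol{r}(\underline{Z})^T\big(\boldsymbol{c}^j-j\,\boldsymbol{A}_k\boldsymbol{c}^{j-1}\big).$$ *)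

theory Defs
  imports Complex_Main Jordan_Normal_Form.Gauss_Jordan_Elimination
begin

section \<open>Norms and matrix operations\<close>

definition linf_norm :: "real vec \<Rightarrow> real" where
  "linf_norm v = Max (insert 0 ((\<lambda>i. \<bar>v $ i\<bar>) ` {..<dim_vec v}))"

definition linf_opnorm :: "real mat \<Rightarrow> real" where
  "linf_opnorm A = (SUP v\<in>{v \<in> carrier_vec (dim_col A). linf_norm v \<le> 1}. linf_norm (A *\<^sub>v v))"

definition kron :: "real mat \<Rightarrow> real mat \<Rightarrow> real mat" where
  "kron A B = mat (dim_row A * dim_row B) (dim_col A * dim_col B)
     (\<lambda>(i, j). A $$ (i div dim_row B, j div dim_col B) * B $$ (i mod dim_row B, j mod dim_col B))"

definition mat_sum :: "nat \<Rightarrow> nat \<Rightarrow> (nat \<Rightarrow> real mat) \<Rightarrow> nat set \<Rightarrow> real mat" where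
  "mat_sum nr nc X K = mat nr nc (\<lambda>ij. \<Sum>k\<in>K. X k $$ ij)"

section \<open>Partitioned Runge-Kutta methods\<close>

text \<open>The parts are numbered \<open>1, \<dots>, r\<close>; vector and matrix entries are numbered from 0.\<close>

record prk =
  parts :: nat
  stages :: nat
  Acoef :: "nat \<Rightarrow> real mat"
  bcoef :: "nat \<Rightarrow> real vec"

definition prk_method :: "prk \<Rightarrow> bool" where
  "prk_method M \<longleftrightarrow> parts M \<ge> 1 \<and> stages M \<ge> 1 \<and>
     (\<forall>k\<in>{1..parts M}. Acoef M k \<in> carrier_mat (stages M) (stages M) \<and>
                       bcoef M k \<in> carrier_vec (stages M))"

definition explicit_prk :: "prk \<Rightarrow> bool" where
  "explicit_prk M \<longleftrightarrow>
     (\<forall>k\<in>{1..parts M}. \<forall>i<stages M. \<forall>j<stages M. i \<le> j \<longrightarrow> Acoef M k $$ (i, j) = 0)"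

definition evec :: "prk \<Rightarrow> real vec" where
  "evec M = vec (stages M) (\<lambda>_. 1)"

definition cvec :: "prk \<Rightarrow> real vec" where
  "cvec M = Acoef M (parts M) *\<^sub>v evec M"

definition cpow :: "prk \<Rightarrow> nat \<Rightarrow> real vec" where
  "cpow M j = vec (stages M) (\<lambda>i. (cvec M $ i) ^ j)"

definition stage_order :: "prk \<Rightarrow> nat \<Rightarrow> bool" where
  "stage_order M q \<longleftrightarrow> (\<forall>k\<in>{1..parts M}. \<forall>j<q.
     Acoef M k *\<^sub>v cpow M j = (1 / real (j + 1)) \<cdot>\<^sub>v cpow M (j + 1))"

text \<open>One step of size \<open>dt\<close> from \<open>(t, y)\<close> to \<open>y'\<close> in dimension \<open>d\<close>, with stage values \<open>V\<close>, written
  componentwise. It is a relation because the stage equations of an implicit method need not have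
  a unique solution; for explicit methods \<open>V\<close> and \<open>y'\<close> exist and are unique.\<close>

definition prk_step :: "prk \<Rightarrow> nat \<Rightarrow> (nat \<Rightarrow> real \<Rightarrow> real vec \<Rightarrow> real vec) \<Rightarrow> real \<Rightarrow> real
    \<Rightarrow> real vec \<Rightarrow> (nat \<Rightarrow> real vec) \<Rightarrow> real vec \<Rightarrow> bool" where
  "prk_step M d F t dt y V y' \<longleftrightarrow>
     y \<in> carrier_vec d \<and> y' \<in> carrier_vec d \<and> (\<forall>i<stages M. V i \<in> carrier_vec d) \<and>
     (\<forall>i<stages M. \<forall>l<d. V i $ l = y $ l + dt * (\<Sum>k\<in>{1..parts M}. \<Sum>j<stages M.
        Acoef M k $$ (i, j) * F k (t + cvec M $ j * dt) (V j) $ l)) \<and>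
     (\<forall>l<d. y' $ l = y $ l + dt * (\<Sum>k\<in>{1..parts M}. \<Sum>j<stages M.
        bcoef M k $ j * F k (t + cvec M $ j * dt) (V j) $ l))"

section \<open>Smoothness and classical order\<close>

definition has_vec_deriv :: "nat \<Rightarrow> (real \<Rightarrow> real vec) \<Rightarrow> real vec \<Rightarrow> real \<Rightarrow> real set \<Rightarrow> bool" where
  "has_vec_deriv d y y' t J \<longleftrightarrow> y t \<in> carrier_vec d \<and> y' \<in> carrier_vec d \<and>
     (\<forall>l<d. ((\<lambda>\<tau>. y \<tau> $ l) has_real_derivative y' $ l) (at t within J))"

definition cont_fn :: "nat \<Rightarrow> (real \<Rightarrow> real vec \<Rightarrow> real) \<Rightarrow> bool" where
  "cont_fn d f \<longleftrightarrow> (\<forall>t. \<forall>x\<in>carrier_vec d. \<forall>\<epsilon>>0. \<exists>\<delta>>0. \<forall>t'. \<forall>x'\<in>carrier_vec d.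
     \<bar>t' - t\<bar> < \<delta> \<and> linf_norm (x' - x) < \<delta> \<longrightarrow> \<bar>f t' x' - f t x\<bar> < \<epsilon>)"

text \<open>\<open>smooth_fn d f\<close>: the function \<open>f\<close> is infinitely often differentiable on \<open>\<real> \<times> \<real>\<^sup>d\<close>, i.e. all
  iterated partial derivatives (in time and in the \<open>d\<close> state variables) exist and are continuous.
  The definition is coinductive, so there is no bound on the order of differentiation.\<close>

coinductive smooth_fn :: "nat \<Rightarrow> (real \<Rightarrow> real vec \<Rightarrow> real) \<Rightarrow> bool" for d where
  "\<lbrakk> cont_fn d f;
     \<forall>t. \<forall>x\<in>carrier_vec d. ((\<lambda>\<tau>. f \<tau> x) has_real_derivative ft t x) (at t);
     smooth_fn d ft;
     \<forall>j<d. \<forall>t. \<forall>x\<in>carrier_vec d.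
       ((\<lambda>\<xi>. f t (vec d (\<lambda>i. if i = j then \<xi> else x $ i))) has_real_derivative fx j t x) (at (x $ j));
     \<forall>j<d. smooth_fn d (fx j) \<rbrakk> \<Longrightarrow> smooth_fn d f"

text \<open>Order of consistency: for every fixed smooth system, every smooth splitting of its right-hand
  side and every exact solution \<open>y\<close>, the error of one step started on \<open>y\<close> is \<open>O(dt\<^sup>p\<^sup>+\<^sup>1)\<close>.
  This is meant for explicit methods; for implicit ones, spurious solutions of the stage equations
  would have to be excluded.\<close>

definition classical_order :: "prk \<Rightarrow> nat \<Rightarrow> bool" where
  "classical_order M p \<longleftrightarrow> (\<forall>d F y t0 h.
     (\<forall>k\<in>{1..parts M}. \<forall>t. \<forall>x\<in>carrier_vec d. F k t x \<in> carrier_vec d) \<and>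
     (\<forall>k\<in>{1..parts M}. \<forall>l<d. smooth_fn d (\<lambda>t x. F k t x $ l)) \<and>
     h > 0 \<and>
     (\<forall>t\<in>{t0..t0+h}. has_vec_deriv d y
        (vec d (\<lambda>l. \<Sum>k\<in>{1..parts M}. F k t (y t) $ l)) t {t0..t0+h})
     \<longrightarrow> (\<exists>C. \<exists>\<delta>>0. \<forall>dt V y'. 0 < dt \<and> dt \<le> \<delta> \<and> dt \<le> h \<and> prk_step M d F t0 dt (y t0) V y'
            \<longrightarrow> linf_norm (y (t0 + dt) - y') \<le> C * dt ^ (p + 1)))"

section \<open>Semi-discrete linear systems with cell-based splitting\<close>

text \<open>\<open>times\<close> is the time interval on which the exact solution \<open>exact\<close> is considered.\<close>

record semidiscrete =
  dim :: nat
  cells :: "nat \<Rightarrow> nat set"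
  Lmat :: "real mat"
  source :: "real \<Rightarrow> real vec"
  exact :: "real \<Rightarrow> real vec"
  times :: "real set"

definition cell_mat :: "semidiscrete \<Rightarrow> nat \<Rightarrow> real mat" where
  "cell_mat P k = mat_diag (dim P) (\<lambda>i. if i \<in> cells P k then 1 else 0)"

definition rhs :: "semidiscrete \<Rightarrow> real \<Rightarrow> real vec \<Rightarrow> real vec" where
  "rhs P t v = Lmat P *\<^sub>v v + source P t"

definition rhs_part :: "semidiscrete \<Rightarrow> nat \<Rightarrow> real \<Rightarrow> real vec \<Rightarrow> real vec" where
  "rhs_part P k t v = cell_mat P k *\<^sub>v rhs P t v"

definition semidiscrete_system :: "nat \<Rightarrow> semidiscrete \<Rightarrow> bool" where
  "semidiscrete_system r P \<longleftrightarrow>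
     disjoint_family_on (cells P) {1..r} \<and> (\<Union>k\<in>{1..r}. cells P k) = {0..<dim P} \<and>
     Lmat P \<in> carrier_mat (dim P) (dim P) \<and>
     (\<forall>a\<in>times P. \<forall>b\<in>times P. {a..b} \<subseteq> times P) \<and>
     (\<forall>t\<in>times P. source P t \<in> carrier_vec (dim P)) \<and>
     (\<forall>t\<in>times P. has_vec_deriv (dim P) (exact P) (rhs P t (exact P t)) t (times P))"

text \<open>\<open>D i\<close> is the \<open>i\<close>-th derivative of the exact solution (one-sided at the end points of \<open>times\<close>).\<close>

definition exact_derivs :: "semidiscrete \<Rightarrow> (nat \<Rightarrow> real \<Rightarrow> real vec) \<Rightarrow> bool" where
  "exact_derivs P D \<longleftrightarrow> (\<forall>t\<in>times P. D 0 t = exact P t) \<and>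
     (\<forall>i. \<forall>t\<in>times P. has_vec_deriv (dim P) (D i) (D (Suc i) t) t (times P))"

text \<open>All time points of the integration over \<open>[0, T]\<close>, including the stage times \<open>t\<^sub>n + c\<^sub>j dt\<close>
  (which may lie outside \<open>[0, T]\<close>).\<close>

definition time_points_in :: "prk \<Rightarrow> real \<Rightarrow> real \<Rightarrow> real set \<Rightarrow> bool" where
  "time_points_in M T dt J \<longleftrightarrow> {0..T} \<subseteq> J \<and>
     (\<forall>n. real (Suc n) * dt \<le> T \<longrightarrow> (\<forall>j<stages M. real n * dt + cvec M $ j * dt \<in> J))"

definition numerical_solution ::
  "prk \<Rightarrow> semidiscrete \<Rightarrow> real \<Rightarrow> real \<Rightarrow> (nat \<Rightarrow> real vec) \<Rightarrow> bool" where
  "numerical_solution M P T dt w \<longleftrightarrow> w 0 = exact P 0 \<and>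
     (\<forall>n. real (Suc n) * dt \<le> T \<longrightarrow>
        (\<exists>V. prk_step M (dim P) (rhs_part P) (real n * dt) dt (w n) V (w (Suc n))))"

section \<open>Stability and error matrices\<close>

text \<open>Vectors in \<open>\<real>\<^sup>s\<close> enter Kronecker products as \<open>s \<times> 1\<close> or (transposed) \<open>1 \<times> s\<close> matrices.\<close>

definition kron_col :: "nat \<Rightarrow> real vec \<Rightarrow> real mat" where
  "kron_col m v = kron (mat_of_cols (dim_vec v) [v]) (1\<^sub>m m)"

definition kron_row :: "nat \<Rightarrow> real vec \<Rightarrow> real mat" where
  "kron_row m v = kron (mat_of_rows (dim_vec v) [v]) (1\<^sub>m m)"

definition rT :: "prk \<Rightarrow> nat \<Rightarrow> (nat \<Rightarrow> real mat) \<Rightarrow> real mat" where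
  "rT M m Z =
    (let s = stages M; K = {1..parts M} in
      mat_sum m (m * s) (\<lambda>k. kron_row m (bcoef M k) * kron (1\<^sub>m s) (Z k)) K *
      the (mat_inverse (1\<^sub>m (m * s) -
        mat_sum (m * s) (m * s) (\<lambda>k. kron (Acoef M k) (1\<^sub>m m) * kron (1\<^sub>m s) (Z k)) K)))"

definition Rmat :: "prk \<Rightarrow> nat \<Rightarrow> (nat \<Rightarrow> real mat) \<Rightarrow> real mat" where
  "Rmat M m Z = 1\<^sub>m m + rT M m Z * kron_col m (evec M)"

text \<open>For \<open>j \<ge> 1\<close> only.\<close>

definition dmat :: "prk \<Rightarrow> nat \<Rightarrow> (nat \<Rightarrow> real mat) \<Rightarrow> nat \<Rightarrow> nat \<Rightarrow> real mat" where
  "dmat M m Z j k =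
     (1\<^sub>m m - real j \<cdot>\<^sub>m (kron_row m (bcoef M k) * kron_col m (cpow M (j - 1)))) +
     rT M m Z * (kron_col m (cpow M j) -
       real j \<cdot>\<^sub>m (kron (Acoef M k) (1\<^sub>m m) * kron_col m (cpow M (j - 1))))"

definition Zmat :: "semidiscrete \<Rightarrow> real \<Rightarrow> nat \<Rightarrow> real mat" where
  "Zmat P dt k = dt \<cdot>\<^sub>m (cell_mat P k * Lmat P)"

end

theory Submission
  imports "HOL-Analysis.Complex_Analysis_Basics" "Jordan_Normal_Form.Determinant" Defs
begin

text \<open>
  Write \<open>\<epsilon>\<close> for the global errors and insert the exact solution into the scheme. Taylor expansion shows
  that the local error is \<open>dt^(q+1) / (q+1)! \<Sum>\<^sub>k d\<^sub>k I\<^sub>k u^(q+1)\<close> plus \<open>O(dt^(q+2))\<close>, where \<open>d\<^sub>k\<close> is the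
  matrix with index \<open>q + 1\<close>: the terms of lower order vanish in the stages by the stage order and in the
  output by the quadrature conditions \<open>b\<^sub>k\<^sup>T c^(j-1) = 1/j\<close>. By the assumption on \<open>W\<close>, the leading
  term is \<open>(R - I) \<xi>\<^sub>n\<close> with \<open>\<xi>\<^sub>n = dt^(q+1) / (q+1)! W u^(q+1)(t\<^sub>n)\<close>. Hence the shifted errors
  \<open>\<epsilon>\<^sub>n + \<xi>\<^sub>n\<close> satisfy the recursion of \<open>R\<close> up to \<open>\<xi>\<^sub>n\<^sub>+\<^sub>1 - \<xi>\<^sub>n + O(dt^(q+2)) = O(dt^(q+2))\<close>, and power
  boundedness of \<open>R\<close> loses only one power of \<open>dt\<close> in the summation.
\<close>

text \<open>The obstacle is uniformity in the mesh: \<open>Z k\<close> is bounded but L is not, so a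
  factor L may never be paid for with a power of dt. Stage defects reach the output through
  \<open>rT\<close>, which is O(1) but not O(dt); the local error is thus only of order dt^(q+1),
  and plain summation over T/dt steps would give order q. The shift recovers the lost power: a term
  (R - I) \<xi> is absorbed into the shifted error and leaves behind only an increment of \<xi>,
  smaller by one power of dt because u^(q+1) has a bounded derivative. Two facts keep L out of the
  Taylor expansion. Along the exact solution each component of F_k is either that of u' or zero, so
  only derivatives of u occur; and classical order is exploited on problems y' = t^i, where it
  yields quadrature conditions free of Jacobians. Since \<open>Z k\<close> need not be small either,
  the inverse inside \<open>rT\<close> cannot be bounded by a Neumann series that converges by
  smallness; explicitness takes its place.\<close>

unbundle no vec_syntax


section \<open>The maximum norm\<close>

lemma abs_index_le_linf_norm: "i < dim_vec v \<Longrightarrow> \<bar>v $ i\<bar> \<le> linf_norm v"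
  unfolding linf_norm_def by (rule Max_ge) auto

lemma linf_norm_nonneg: "0 \<le> linf_norm v"
  unfolding linf_norm_def by (rule Max_ge) auto

lemma linf_norm_leI:
  assumes "0 \<le> c" "\<And>i. i < dim_vec v \<Longrightarrow> \<bar>v $ i\<bar> \<le> c"
  shows "linf_norm v \<le> c"
  unfolding linf_norm_def using assms by (subst Max_le_iff) auto

lemma linf_norm_triangle:
  assumes "v \<in> carrier_vec d" "w \<in> carrier_vec d"
  shows "linf_norm (v + w) \<le> linf_norm v + linf_norm w"
proof (rule linf_norm_leI)
  fix i assume "i < dim_vec (v + w)"
  then show "\<bar>(v + w) $ i\<bar> \<le> linf_norm v + linf_norm w"
    using assms abs_index_le_linf_norm[of i v] abs_index_le_linf_norm[of i w] by auto
qed (simp add: linf_norm_nonneg)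

lemma linf_norm_smult: "linf_norm (c \<cdot>\<^sub>v v) \<le> \<bar>c\<bar> * linf_norm v"
  by (rule linf_norm_leI)
    (auto simp: abs_mult linf_norm_nonneg intro!: mult_left_mono abs_index_le_linf_norm)

lemma linf_norm_diff_le:
  assumes "v \<in> carrier_vec d" "w \<in> carrier_vec d"
  shows "linf_norm (v - w) \<le> linf_norm v + linf_norm w"
proof -
  have "v - w = v + (-1) \<cdot>\<^sub>v w" using assms by (intro eq_vecI) auto
  then show ?thesis
    using linf_norm_triangle[of v d "(-1) \<cdot>\<^sub>v w"] linf_norm_smult[of "-1" w] assms by simp
qed

lemma linf_norm_zero: "linf_norm (0\<^sub>v d) = 0"
  by (rule antisym[OF linf_norm_leI linf_norm_nonneg]) auto

lemma linf_norm_eq_0D: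
  assumes "v \<in> carrier_vec d" "linf_norm v \<le> 0"
  shows "v = 0\<^sub>v d"
  using assms abs_index_le_linf_norm[of _ v] by (intro eq_vecI) force+

section \<open>The induced matrix norm\<close>

lemma linf_opnorm_bdd_above:
  "bdd_above ((\<lambda>v. linf_norm (A *\<^sub>v v)) ` {v \<in> carrier_vec (dim_col A). linf_norm v \<le> 1})"
proof (rule bdd_aboveI2)
  fix v assume v: "v \<in> {v \<in> carrier_vec (dim_col A). linf_norm v \<le> 1}"
  show "linf_norm (A *\<^sub>v v) \<le> (\<Sum>i<dim_row A. \<Sum>j<dim_col A. \<bar>A $$ (i, j)\<bar>)"
  proof (rule linf_norm_leI)
    fix i assume "i < dim_vec (A *\<^sub>v v)"
    then have i: "i < dim_row A" by simp
    have v1: "\<bar>v $ j\<bar> \<le> 1" if "j < dim_col A" for j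
      using v that abs_index_le_linf_norm[of j v] by auto
    have "\<bar>(A *\<^sub>v v) $ i\<bar> = \<bar>\<Sum>j<dim_col A. A $$ (i, j) * v $ j\<bar>"
      using i v by (auto simp: scalar_prod_def atLeast0LessThan)
    also have "\<dots> \<le> (\<Sum>j<dim_col A. \<bar>A $$ (i, j) * v $ j\<bar>)" by (rule sum_abs)
    also have "\<dots> \<le> (\<Sum>j<dim_col A. \<bar>A $$ (i, j)\<bar>)"
      using v1 by (intro sum_mono) (auto simp: abs_mult intro: mult_left_le)
    also have "\<dots> \<le> (\<Sum>i<dim_row A. \<Sum>j<dim_col A. \<bar>A $$ (i, j)\<bar>)"
      using i by (intro member_le_sum) (auto intro: sum_nonneg)
    finally show "\<bar>(A *\<^sub>v v) $ i\<bar> \<le> (\<Sum>i<dim_row A. \<Sum>j<dim_col A. \<bar>A $$ (i, j)\<bar>)" .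
  qed (auto intro!: sum_nonneg)
qed

text \<open>A real supremum bounds its elements only over a set that is bounded above, which is why
  the crude bound by the sum of all absolute entries comes first.\<close>

lemma linf_norm_le_linf_opnorm:
  "v \<in> carrier_vec (dim_col A) \<Longrightarrow> linf_norm v \<le> 1 \<Longrightarrow> linf_norm (A *\<^sub>v v) \<le> linf_opnorm A"
  unfolding linf_opnorm_def by (rule cSUP_upper[OF _ linf_opnorm_bdd_above]) auto

lemma linf_opnorm_nonneg: "0 \<le> linf_opnorm A"
  using linf_norm_le_linf_opnorm[of "0\<^sub>v (dim_col A)" A] linf_norm_nonneg[of "A *\<^sub>v 0\<^sub>v (dim_col A)"]
  by (simp add: linf_norm_zero)

lemma linf_norm_mult_mat_vec:
  assumes A: "A \<in> carrier_mat a b" and v: "v \<in> carrier_vec b"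
  shows "linf_norm (A *\<^sub>v v) \<le> linf_opnorm A * linf_norm v"
proof (cases "linf_norm v = 0")
  case True
  then have "v = 0\<^sub>v b" using v linf_norm_eq_0D by simp
  then have "A *\<^sub>v v = 0\<^sub>v a" using A by auto
  then show ?thesis using True by (simp add: linf_norm_zero)
next
  case False
  define c where "c = linf_norm v"
  have c: "c > 0" using False linf_norm_nonneg[of v] by (simp add: c_def)
  define w where "w = (1 / c) \<cdot>\<^sub>v v"
  have w: "w \<in> carrier_vec b" using v by (simp add: w_def)
  have "v = c \<cdot>\<^sub>v w" using v c by (auto simp: w_def)
  then have "A *\<^sub>v v = c \<cdot>\<^sub>v (A *\<^sub>v w)" using mult_mat_vec[OF A w] by simp
  then have "linf_norm (A *\<^sub>v v) \<le> c * linf_norm (A *\<^sub>v w)"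
    using linf_norm_smult[of c "A *\<^sub>v w"] c by simp
  moreover have "linf_norm w \<le> 1"
    using linf_norm_smult[of "1 / c" v] c by (simp add: w_def c_def)
  then have "linf_norm (A *\<^sub>v w) \<le> linf_opnorm A"
    using linf_norm_le_linf_opnorm w A by auto
  ultimately show ?thesis using c by (simp add: c_def mult.commute) (smt (verit) mult_left_mono)
qed

lemma linf_norm_mult_mat_vec_le:
  assumes "A \<in> carrier_mat a b" "v \<in> carrier_vec b" "linf_opnorm A \<le> c"
  shows "linf_norm (A *\<^sub>v v) \<le> c * linf_norm v"
  using linf_norm_mult_mat_vec[OF assms(1,2)] mult_right_mono[OF assms(3) linf_norm_nonneg[of v]]
  by linarith

section \<open>Block vectors and Kronecker products\<close>

definition vsum :: "nat \<Rightarrow> (nat \<Rightarrow> real vec) \<Rightarrow> nat set \<Rightarrow> real vec" where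
  "vsum d y K = vec d (\<lambda>i. \<Sum>k\<in>K. y k $ i)"

lemma vsum_carrier [simp]: "vsum d y K \<in> carrier_vec d"
  by (simp add: vsum_def)

lemma mult_mat_vec_index:
  "A \<in> carrier_mat a b \<Longrightarrow> v \<in> carrier_vec b \<Longrightarrow> i < a \<Longrightarrow> (A *\<^sub>v v) $ i = (\<Sum>j<b. A $$ (i, j) * v $ j)"
  by (auto simp: scalar_prod_def atLeast0LessThan)

lemma smult_mat_mult_vec:
  fixes A :: "real mat"
  assumes "A \<in> carrier_mat a b" "v \<in> carrier_vec b"
  shows "(k \<cdot>\<^sub>m A) *\<^sub>v v = k \<cdot>\<^sub>v (A *\<^sub>v v)"
  using assms by (intro eq_vecI) (auto simp: scalar_prod_def sum_distrib_left mult.assoc)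

lemma mult_mat_vsum:
  assumes A: "A \<in> carrier_mat a b" and y: "\<And>k. k \<in> K \<Longrightarrow> y k \<in> carrier_vec b"
  shows "A *\<^sub>v vsum b y K = vsum a (\<lambda>k. A *\<^sub>v y k) K"
proof (rule eq_vecI)
  fix i assume "i < dim_vec (vsum a (\<lambda>k. A *\<^sub>v y k) K)"
  then have i: "i < a" by (simp add: vsum_def)
  have "(A *\<^sub>v vsum b y K) $ i = (\<Sum>j<b. A $$ (i, j) * (\<Sum>k\<in>K. y k $ j))"
    by (simp only: mult_mat_vec_index[OF A vsum_carrier i]) (simp add: vsum_def)
  also have "\<dots> = (\<Sum>k\<in>K. \<Sum>j<b. A $$ (i, j) * y k $ j)"
    by (simp add: sum_distrib_left) (rule sum.swap)
  finally show "(A *\<^sub>v vsum b y K) $ i = vsum a (\<lambda>k. A *\<^sub>v y k) K $ i"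
    using i by (simp add: vsum_def mult_mat_vec_index[OF A y] del: index_mult_mat_vec)
qed (use A in \<open>auto simp: vsum_def\<close>)

lemma mat_sum_carrier [simp]: "mat_sum a b X K \<in> carrier_mat a b"
  by (simp add: mat_sum_def)

lemma mat_sum_mult_vec:
  assumes X: "\<And>k. k \<in> K \<Longrightarrow> X k \<in> carrier_mat a b" and v: "v \<in> carrier_vec b"
  shows "mat_sum a b X K *\<^sub>v v = vsum a (\<lambda>k. X k *\<^sub>v v) K"
proof (rule eq_vecI)
  fix i assume "i < dim_vec (vsum a (\<lambda>k. X k *\<^sub>v v) K)"
  then have i: "i < a" by (simp add: vsum_def)
  have "(mat_sum a b X K *\<^sub>v v) $ i = (\<Sum>j<b. (\<Sum>k\<in>K. X k $$ (i, j)) * v $ j)"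
    using i by (simp add: mult_mat_vec_index[OF mat_sum_carrier v] del: index_mult_mat_vec)
      (simp add: mat_sum_def)
  also have "\<dots> = (\<Sum>k\<in>K. \<Sum>j<b. X k $$ (i, j) * v $ j)"
    by (simp add: sum_distrib_right) (rule sum.swap)
  finally show "(mat_sum a b X K *\<^sub>v v) $ i = vsum a (\<lambda>k. X k *\<^sub>v v) K $ i"
    using i by (simp add: vsum_def mult_mat_vec_index[OF X v] del: index_mult_mat_vec)
qed (auto simp: vsum_def mat_sum_def)

text \<open>Block \<open>p div d\<close>, component \<open>p mod d\<close>: the index convention of
  \<open>kron\<close>, so that a Kronecker product acts block by block.\<close>

definition stack :: "nat \<Rightarrow> nat \<Rightarrow> (nat \<Rightarrow> real vec) \<Rightarrow> real vec" where
  "stack d s y = vec (d * s) (\<lambda>p. y (p div d) $ (p mod d))"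

lemma stack_carrier [simp]: "stack d s y \<in> carrier_vec (d * s)"
  by (simp add: stack_def)

lemma block_index_less:
  fixes d s i l :: nat
  assumes "i < s" "l < d"
  shows "i * d + l < d * s"
proof -
  have "i * d + l < Suc i * d" using assms by simp
  also have "\<dots> \<le> s * d" using assms by (intro mult_le_mono1) simp
  finally show ?thesis by (simp add: mult.commute)
qed

lemma div_mod_less:
  fixes d s p :: nat
  assumes "p < d * s"
  shows "p div d < s" "p mod d < d"
proof -
  have "d > 0" using assms by (cases d) auto
  then show "p div d < s" "p mod d < d"
    using assms by (auto simp: less_mult_imp_div_less mult.commute)
qed

lemma stack_index: "i < s \<Longrightarrow> l < d \<Longrightarrow> stack d s y $ (i * d + l) = y i $ l"
  using block_index_less[of i s l d] by (simp add: stack_def)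

lemma stack_cong:
  "(\<And>i l. i < s \<Longrightarrow> l < d \<Longrightarrow> y i $ l = z i $ l) \<Longrightarrow> stack d s y = stack d s z"
  by (rule eq_vecI) (auto simp: stack_def div_mod_less)

lemma stack_blocks:
  assumes "v \<in> carrier_vec (d * s)"
  shows "stack d s (\<lambda>i. vec d (\<lambda>l. v $ (i * d + l))) = v"
  using assms by (intro eq_vecI) (auto simp: stack_def div_mod_less)

lemma stack_one: "v \<in> carrier_vec d \<Longrightarrow> stack d 1 (\<lambda>_. v) = v"
  by (rule eq_vecI) (auto simp: stack_def)

lemma linf_norm_stack_le:
  assumes "0 \<le> c" "\<And>i. i < s \<Longrightarrow> y i \<in> carrier_vec d" "\<And>i. i < s \<Longrightarrow> linf_norm (y i) \<le> c"
  shows "linf_norm (stack d s y) \<le> c"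
proof (rule linf_norm_leI[OF assms(1)])
  fix p assume "p < dim_vec (stack d s y)"
  then have p: "p < d * s" by (simp add: stack_def)
  have "\<bar>y (p div d) $ (p mod d)\<bar> \<le> linf_norm (y (p div d))"
    using assms(2)[of "p div d"] p by (intro abs_index_le_linf_norm) (auto simp: div_mod_less)
  then show "\<bar>stack d s y $ p\<bar> \<le> c"
    using p assms(3)[of "p div d"] by (simp add: stack_def div_mod_less)
qed

lemma linf_norm_block_le:
  assumes "i < s" "y i \<in> carrier_vec d"
  shows "linf_norm (y i) \<le> linf_norm (stack d s y)"
proof (rule linf_norm_leI[OF linf_norm_nonneg])
  fix l assume "l < dim_vec (y i)"
  then have l: "l < d" using assms by simp
  show "\<bar>y i $ l\<bar> \<le> linf_norm (stack d s y)"
    using abs_index_le_linf_norm[of "i * d + l" "stack d s y"] block_index_less[OF assms(1) l]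
      stack_index[OF assms(1) l, of y] by (simp add: stack_def)
qed

section \<open>Kronecker products acting on block vectors\<close>

lemma kron_carrier:
  "A \<in> carrier_mat a b \<Longrightarrow> B \<in> carrier_mat m n \<Longrightarrow> kron A B \<in> carrier_mat (m * a) (n * b)"
  by (auto simp: kron_def mult.commute)

lemma kron_mult_stack:
  assumes A: "A \<in> carrier_mat a b" and B: "B \<in> carrier_mat m n"
    and y: "\<And>j. j < b \<Longrightarrow> y j \<in> carrier_vec n"
  shows "kron A B *\<^sub>v stack n b y = stack m a (\<lambda>i. vec m (\<lambda>l. \<Sum>j<b. A $$ (i, j) * (B *\<^sub>v y j) $ l))"
proof (rule eq_vecI)
  fix p assume "p < dim_vec (stack m a (\<lambda>i. vec m (\<lambda>l. \<Sum>j<b. A $$ (i, j) * (B *\<^sub>v y j) $ l)))"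
  then have p: "p < m * a" by (simp add: stack_def)
  let ?i = "p div m" and ?l = "p mod m"
  have il: "?i < a" "?l < m" using p by (auto simp: div_mod_less)
  have "(kron A B *\<^sub>v stack n b y) $ p = (\<Sum>q<n * b. kron A B $$ (p, q) * stack n b y $ q)"
    by (rule mult_mat_vec_index[OF kron_carrier[OF A B] stack_carrier p])
  also have "\<dots> = (\<Sum>q<b * n. A $$ (?i, q div n) * (B $$ (?l, q mod n) * y (q div n) $ (q mod n)))"
    using p A B by (intro sum.cong) (auto simp: kron_def stack_def mult.commute)
  \<comment> \<open>The column indices are cut into \<open>b\<close> runs of length
    \<open>n\<close>; on run number j the block index \<open>q div n\<close> is constantly
    j.\<close>
  also have "\<dots> = (\<Sum>j<b. \<Sum>q = j * n..<j * n + n.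
      A $$ (?i, q div n) * (B $$ (?l, q mod n) * y (q div n) $ (q mod n)))"
    by (rule sum.nat_group[symmetric])
  also have "\<dots> = (\<Sum>j<b. \<Sum>l'<n. A $$ (?i, j) * (B $$ (?l, l') * y j $ l'))"
  proof (rule sum.cong[OF refl])
    fix j
    have shift: "sum g {j * n..<j * n + n} = (\<Sum>q = 0..<n. g (q + j * n))" for g :: "nat \<Rightarrow> real"
      using sum.shift_bounds_nat_ivl[of _ 0 "j * n" n] by (simp add: add.commute)
    have "(\<Sum>q = j * n..<j * n + n. A $$ (?i, q div n) * (B $$ (?l, q mod n) * y (q div n) $ (q mod n)))
        = (\<Sum>q = 0..<n. A $$ (?i, (q + j * n) div n) * (B $$ (?l, (q + j * n) mod n)
            * y ((q + j * n) div n) $ ((q + j * n) mod n)))"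
      by (rule shift)
    also have "\<dots> = (\<Sum>l'<n. A $$ (?i, j) * (B $$ (?l, l') * y j $ l'))"
      by (rule sum.cong) auto
    finally show "(\<Sum>q = j * n..<j * n + n.
        A $$ (?i, q div n) * (B $$ (?l, q mod n) * y (q div n) $ (q mod n)))
        = (\<Sum>l'<n. A $$ (?i, j) * (B $$ (?l, l') * y j $ l'))" .
  qed
  also have "\<dots> = (\<Sum>j<b. A $$ (?i, j) * (B *\<^sub>v y j) $ ?l)"
    using y by (intro sum.cong refl)
      (simp add: sum_distrib_left mult_mat_vec_index[OF B _ il(2)] del: index_mult_mat_vec)
  finally show "(kron A B *\<^sub>v stack n b y) $ p
      = stack m a (\<lambda>i. vec m (\<lambda>l. \<Sum>j<b. A $$ (i, j) * (B *\<^sub>v y j) $ l)) $ p"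
    using p il by (simp add: stack_def)
qed (use kron_carrier[OF A B] in \<open>auto simp: stack_def\<close>)

lemma kron_one_mult_stack:
  assumes "A \<in> carrier_mat a b" "\<And>j. j < b \<Longrightarrow> y j \<in> carrier_vec m"
  shows "kron A (1\<^sub>m m) *\<^sub>v stack m b y = stack m a (\<lambda>i. vec m (\<lambda>l. \<Sum>j<b. A $$ (i, j) * y j $ l))"
  using assms by (subst kron_mult_stack[OF assms(1) one_carrier_mat])
    (auto intro!: stack_cong sum.cong simp del: index_mult_mat_vec)

lemma one_kron_mult_stack:
  assumes "B \<in> carrier_mat m n" "\<And>j. j < s \<Longrightarrow> y j \<in> carrier_vec n"
  shows "kron (1\<^sub>m s) B *\<^sub>v stack n s y = stack m s (\<lambda>i. B *\<^sub>v y i)"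
proof -
  have "(\<Sum>j<s. 1\<^sub>m s $$ (i, j) * (B *\<^sub>v y j) $ l) = (B *\<^sub>v y i) $ l" if "i < s" for i l
  proof -
    have "(\<Sum>j<s. 1\<^sub>m s $$ (i, j) * (B *\<^sub>v y j) $ l) = (\<Sum>j<s. if j = i then (B *\<^sub>v y j) $ l else 0)"
      using that by (intro sum.cong) auto
    then show ?thesis using that by simp
  qed
  then show ?thesis
    using assms by (subst kron_mult_stack[OF one_carrier_mat assms(1)])
      (auto intro!: stack_cong simp del: index_mult_mat_vec)
qed

lemma kron_col_carrier: "v \<in> carrier_vec s \<Longrightarrow> kron_col m v \<in> carrier_mat (m * s) m"
  using kron_carrier[OF carrier_matI[of "mat_of_cols s [v]" s 1] one_carrier_mat[of m]]
  by (simp add: kron_col_def)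

lemma kron_row_carrier: "v \<in> carrier_vec s \<Longrightarrow> kron_row m v \<in> carrier_mat m (m * s)"
  using kron_carrier[OF carrier_matI[of "mat_of_rows s [v]" 1 s] one_carrier_mat[of m]]
  by (simp add: kron_row_def)

text \<open>A plain vector is a stack with a single block, which makes this an instance of the
  blockwise action.\<close>

lemma kron_col_mult_vec:
  assumes v: "v \<in> carrier_vec s" and x: "x \<in> carrier_vec m"
  shows "kron_col m v *\<^sub>v x = stack m s (\<lambda>i. v $ i \<cdot>\<^sub>v x)"
proof -
  have A: "mat_of_cols s [v] \<in> carrier_mat s 1" by (intro carrier_matI) simp_all
  have "kron_col m v *\<^sub>v x = kron (mat_of_cols s [v]) (1\<^sub>m m) *\<^sub>v stack m 1 (\<lambda>_. x)"
    using v x by (simp add: kron_col_def stack_one del: One_nat_def)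
  also have "\<dots> = stack m s (\<lambda>i. vec m (\<lambda>l. \<Sum>j<1. mat_of_cols s [v] $$ (i, j) * x $ l))"
    by (rule kron_one_mult_stack[OF A x])
  also have "\<dots> = stack m s (\<lambda>i. v $ i \<cdot>\<^sub>v x)"
    using x v by (intro stack_cong) (auto simp: mat_of_cols_index)
  finally show ?thesis .
qed

lemma kron_row_mult_stack:
  assumes v: "v \<in> carrier_vec s" and y: "\<And>j. j < s \<Longrightarrow> y j \<in> carrier_vec m"
  shows "kron_row m v *\<^sub>v stack m s y = vec m (\<lambda>l. \<Sum>j<s. v $ j * y j $ l)"
proof -
  have A: "mat_of_rows s [v] \<in> carrier_mat 1 s" by (intro carrier_matI) simp_all
  have "kron_row m v *\<^sub>v stack m s y
      = stack m 1 (\<lambda>i. vec m (\<lambda>l. \<Sum>j<s. mat_of_rows s [v] $$ (i, j) * y j $ l))"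
    using kron_one_mult_stack[OF A y] v by (simp add: kron_row_def)
  also have "\<dots> = stack m 1 (\<lambda>_. vec m (\<lambda>l. \<Sum>j<s. v $ j * y j $ l))"
    using v by (intro stack_cong) (auto simp: mat_of_rows_index)
  also have "\<dots> = vec m (\<lambda>l. \<Sum>j<s. v $ j * y j $ l)" by (rule stack_one) simp
  finally show ?thesis .
qed

section \<open>Taylor expansion of quadrature defects\<close>

text \<open>Serves stages and output alike: \<alpha> is a row of some A_k with \<gamma> = c_i, or
  \<alpha> = b_k with \<gamma> = 1. When \<open>f 0\<close> and its derivative \<open>f 1\<close>
  are expanded at t, the coefficient of h^(i+1) measures the failure of the quadrature rule on the
  monomial of degree i. It vanishes for i < q; the case i = q is the leading term subtracted on the
  left.\<close>

lemma taylor_defect: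
  fixes f :: "nat \<Rightarrow> real \<Rightarrow> real"
  assumes S: "convex S"
    and f: "\<And>i x. x \<in> S \<Longrightarrow> i \<le> Suc q \<Longrightarrow> (f i has_real_derivative f (Suc i) x) (at x within S)"
    and B: "\<And>x. x \<in> S \<Longrightarrow> \<bar>f (q + 2) x\<bar> \<le> B"
    and pts: "t \<in> S" "t + \<gamma> * h \<in> S" "\<And>j. j < s \<Longrightarrow> t + c j * h \<in> S"
    and h: "h \<ge> 0"
    and quad: "\<And>i. i < q \<Longrightarrow> (\<Sum>j<s. \<alpha> j * c j ^ i) = \<gamma> ^ Suc i / real (Suc i)"
  shows "\<bar>f 0 (t + \<gamma> * h) - f 0 t - h * (\<Sum>j<s. \<alpha> j * f 1 (t + c j * h))
      - h ^ (q + 1) / fact (q + 1) * ((\<gamma> ^ (q + 1) - real (q + 1) * (\<Sum>j<s. \<alpha> j * c j ^ q)) * f (q + 1) t)\<bar>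
    \<le> B * (\<bar>\<gamma>\<bar> ^ (q + 2) + (\<Sum>j<s. \<bar>\<alpha> j\<bar> * \<bar>c j\<bar> ^ (q + 1))) * h ^ (q + 2)"
proof -
  have B0: "0 \<le> B" using B[OF pts(1)] by linarith
  \<comment> \<open>Remainders of \<open>f 0\<close> to degree q + 1, but of \<open>f 1\<close> to
    degree q only: the factor h in front of the sum makes up for the difference, and
    \<open>f (q + 2)\<close> controls both.\<close>
  define X where "X = f 0 (t + \<gamma> * h) - (\<Sum>i\<le>Suc q. f i t * (\<gamma> * h) ^ i / fact i)"
  define Y where "Y j = f 1 (t + c j * h) - (\<Sum>i\<le>q. f (Suc i) t * (c j * h) ^ i / fact i)" for j
  have div_fact: "x / fact n \<le> x" if "0 \<le> x" for x :: real and n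
    using that fact_ge_1[of n, where 'a=real] by (simp add: divide_le_eq mult_left_le_one_le mult_le_cancel_left1)
  have X: "\<bar>X\<bar> \<le> B * \<bar>\<gamma>\<bar> ^ (q + 2) * h ^ (q + 2)"
  proof -
    have "\<bar>X\<bar> \<le> B * \<bar>\<gamma> * h\<bar> ^ Suc (Suc q) / fact (Suc q)"
      using field_Taylor[OF S, of "Suc q" f B t "t + \<gamma> * h"] f pts B by (simp add: X_def)
    also have "\<dots> \<le> B * \<bar>\<gamma> * h\<bar> ^ Suc (Suc q)" using B0 by (intro div_fact) simp
    finally show ?thesis using h by (simp add: abs_mult power_mult_distrib algebra_simps)
  qed
  have Y: "\<bar>Y j\<bar> \<le> B * \<bar>c j\<bar> ^ (q + 1) * h ^ (q + 1)" if "j < s" for j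
  proof -
    have "\<bar>Y j\<bar> \<le> B * \<bar>c j * h\<bar> ^ Suc q / fact q"
      using field_Taylor[OF S, of q "\<lambda>i. f (Suc i)" B t "t + c j * h"] f pts B that by (simp add: Y_def)
    also have "\<dots> \<le> B * \<bar>c j * h\<bar> ^ Suc q" using B0 by (intro div_fact) simp
    finally show ?thesis using h by (simp add: abs_mult power_mult_distrib algebra_simps)
  qed
  \<comment> \<open>The terms in h^(i+1) of both expansions, over the common factorial of i +
    1.\<close>
  define \<beta> where "\<beta> i = h ^ Suc i / fact (Suc i) *
      ((\<gamma> ^ Suc i - real (Suc i) * (\<Sum>j<s. \<alpha> j * c j ^ i)) * f (Suc i) t)" for i
  have "(\<Sum>j<s. \<alpha> j * f 1 (t + c j * h))
      = (\<Sum>j<s. \<alpha> j * (Y j + (\<Sum>i\<le>q. f (Suc i) t * (c j * h) ^ i / fact i)))"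
    by (simp add: Y_def)
  also have "\<dots> = (\<Sum>j<s. \<alpha> j * Y j) + (\<Sum>j<s. \<Sum>i\<le>q. \<alpha> j * (f (Suc i) t * (c j * h) ^ i / fact i))"
    by (simp add: distrib_left sum.distrib sum_distrib_left)
  also have "(\<Sum>j<s. \<Sum>i\<le>q. \<alpha> j * (f (Suc i) t * (c j * h) ^ i / fact i))
      = (\<Sum>i\<le>q. \<Sum>j<s. \<alpha> j * (f (Suc i) t * (c j * h) ^ i / fact i))"
    by (rule sum.swap)
  also have "\<dots> = (\<Sum>i\<le>q. f (Suc i) t * h ^ i / fact i * (\<Sum>j<s. \<alpha> j * c j ^ i))"
    by (simp add: sum_distrib_left sum_divide_distrib power_mult_distrib algebra_simps)
  finally have sumf: "h * (\<Sum>j<s. \<alpha> j * f 1 (t + c j * h)) = h * (\<Sum>j<s. \<alpha> j * Y j)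
      + (\<Sum>i\<le>q. f (Suc i) t * h ^ Suc i / fact i * (\<Sum>j<s. \<alpha> j * c j ^ i))"
    by (simp add: distrib_left sum_distrib_left algebra_simps)
  have "f 0 (t + \<gamma> * h) - f 0 t = X + (\<Sum>i\<le>q. f (Suc i) t * (\<gamma> * h) ^ Suc i / fact (Suc i))"
    unfolding X_def by (subst sum.atMost_Suc_shift) simp
  then have "f 0 (t + \<gamma> * h) - f 0 t - h * (\<Sum>j<s. \<alpha> j * f 1 (t + c j * h))
      = X - h * (\<Sum>j<s. \<alpha> j * Y j) + (\<Sum>i\<le>q. f (Suc i) t * (\<gamma> * h) ^ Suc i / fact (Suc i)
         - f (Suc i) t * h ^ Suc i / fact i * (\<Sum>j<s. \<alpha> j * c j ^ i))"
    unfolding sumf by (simp add: sum_subtractf)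
  also have "(\<Sum>i\<le>q. f (Suc i) t * (\<gamma> * h) ^ Suc i / fact (Suc i)
         - f (Suc i) t * h ^ Suc i / fact i * (\<Sum>j<s. \<alpha> j * c j ^ i)) = (\<Sum>i\<le>q. \<beta> i)"
  proof (rule sum.cong[OF refl])
    fix i
    have "(1::real) / fact i = real (Suc i) / fact (Suc i)"
      by (simp add: divide_simps del: of_nat_Suc)
    then show "f (Suc i) t * (\<gamma> * h) ^ Suc i / fact (Suc i)
         - f (Suc i) t * h ^ Suc i / fact i * (\<Sum>j<s. \<alpha> j * c j ^ i) = \<beta> i"
      unfolding \<beta>_def power_mult_distrib by (simp add: field_simps del: power_Suc of_nat_Suc fact_Suc)
  qed
  also have "(\<Sum>i\<le>q. \<beta> i) = (\<Sum>i\<in>{q}. \<beta> i)"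
    using quad by (intro sum.mono_neutral_right) (auto simp: \<beta>_def simp del: of_nat_Suc)
  finally have "f 0 (t + \<gamma> * h) - f 0 t - h * (\<Sum>j<s. \<alpha> j * f 1 (t + c j * h)) - \<beta> q
      = X - h * (\<Sum>j<s. \<alpha> j * Y j)"
    by simp
  moreover have "\<bar>h * (\<Sum>j<s. \<alpha> j * Y j)\<bar> \<le> B * (\<Sum>j<s. \<bar>\<alpha> j\<bar> * \<bar>c j\<bar> ^ (q + 1)) * h ^ (q + 2)"
  proof -
    have "\<bar>\<Sum>j<s. \<alpha> j * Y j\<bar> \<le> (\<Sum>j<s. \<bar>\<alpha> j\<bar> * (B * \<bar>c j\<bar> ^ (q + 1) * h ^ (q + 1)))"
    proof (rule order_trans[OF sum_abs], rule sum_mono)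
      fix j assume "j \<in> {..<s}"
      then show "\<bar>\<alpha> j * Y j\<bar> \<le> \<bar>\<alpha> j\<bar> * (B * \<bar>c j\<bar> ^ (q + 1) * h ^ (q + 1))"
        unfolding abs_mult by (intro mult_left_mono Y) auto
    qed
    also have "\<dots> = B * (\<Sum>j<s. \<bar>\<alpha> j\<bar> * \<bar>c j\<bar> ^ (q + 1)) * h ^ (q + 1)"
      by (simp add: sum_distrib_left sum_distrib_right algebra_simps)
    finally have "h * \<bar>\<Sum>j<s. \<alpha> j * Y j\<bar> \<le> h * (B * (\<Sum>j<s. \<bar>\<alpha> j\<bar> * \<bar>c j\<bar> ^ (q + 1)) * h ^ (q + 1))"
      using h by (rule mult_left_mono)
    then show ?thesis using h by (simp add: abs_mult algebra_simps)
  qed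
  ultimately show ?thesis using X by (simp add: \<beta>_def algebra_simps)
qed

section \<open>Quadrature conditions\<close>

text \<open>Coinduction over all monomials in t: the class is closed under the time derivative, and
  the state derivatives are the zero monomial.\<close>

lemma smooth_fn_monomial: "smooth_fn d (\<lambda>t x. a * t ^ n)"
proof -
  have cont: "cont_fn d (\<lambda>t x. a * t ^ n)" for a n
  proof -
    have "\<exists>\<delta>>0. \<forall>t'. \<bar>t' - t\<bar> < \<delta> \<longrightarrow> \<bar>a * t' ^ n - a * t ^ n\<bar> < \<epsilon>" if "\<epsilon> > 0" for t \<epsilon> :: real
    proof -
      have "continuous (at t) (\<lambda>t. a * t ^ n)" by (intro continuous_intros)
      then show ?thesis using that unfolding continuous_at_eps_delta dist_real_def by blast
    qed
    then show ?thesis unfolding cont_fn_def by blast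
  qed
  define X where "X f \<longleftrightarrow> (\<exists>a n. f = (\<lambda>t x. a * t ^ n))" for f :: "real \<Rightarrow> real Matrix.vec \<Rightarrow> real"
  have XI: "X (\<lambda>t x. a * t ^ n)" for a n unfolding X_def by blast
  show ?thesis
  proof (rule smooth_fn.coinduct[of X, OF XI])
    fix f assume "X f"
    then obtain a n where f: "f = (\<lambda>t x. a * t ^ n)" by (auto simp: X_def)
    \<comment> \<open>For n = 0 the truncated exponent n - 1 is harmless, as the factor
      \<open>real n\<close> vanishes.\<close>
    have "X (\<lambda>t x. (a * real n) * t ^ (n - 1))" "X (\<lambda>t x. 0)"
      using XI[of "a * real n" "n - 1"] XI[of 0 0] by simp_all
    moreover have "((\<lambda>\<tau>. f \<tau> x) has_real_derivative (a * real n) * t ^ (n - 1)) (at t)" for t and x :: "real Matrix.vec"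
      unfolding f by (auto intro!: derivative_eq_intros)
    moreover have "((\<lambda>\<xi>. f t (Matrix.vec d (\<lambda>i. if i = j then \<xi> else x $ i))) has_real_derivative 0) (at (x $ j))"
      for t j x
      unfolding f by simp
    ultimately show "\<exists>g ft fx. f = g \<and> cont_fn d g \<and>
        (\<forall>t. \<forall>x\<in>carrier_vec d. ((\<lambda>\<tau>. g \<tau> x) has_real_derivative ft t x) (at t)) \<and>
        (X ft \<or> smooth_fn d ft) \<and>
        (\<forall>j<d. \<forall>t. \<forall>x\<in>carrier_vec d. ((\<lambda>\<xi>. g t (Matrix.vec d (\<lambda>i. if i = j then \<xi> else x $ i)))
          has_real_derivative fx j t x) (at (x $ j))) \<and>
        (\<forall>j<d. X (fx j) \<or> smooth_fn d (fx j))"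
      using cont[of a n] unfolding f
      by (intro exI[of _ f] exI[of _ "\<lambda>t x. (a * real n) * t ^ (n - 1)"] exI[of _ "\<lambda>j t x. 0"])
        (auto simp: f)
  qed
qed

text \<open>The order is tested on y' = t^i in dimension one, with the whole right-hand side given
  to part k. A step from 0 then applies the quadrature rule b_k with nodes c, and its error is
  dt^(i+1) times a fixed number. Being O(dt^(p+1)) with i < p, it forces that number to be
  zero.\<close>

lemma quadrature_conditions:
  assumes rk: "prk_method M" and p: "classical_order M p" and k: "k \<in> {1..parts M}" and i: "i < p"
  shows "(\<Sum>j<stages M. bcoef M k $ j * cvec M $ j ^ i) = 1 / real (Suc i)"
proof -
  define F :: "nat \<Rightarrow> real \<Rightarrow> real Matrix.vec \<Rightarrow> real Matrix.vec"
    where "F k' t x = Matrix.vec 1 (\<lambda>_. (if k' = k then 1 else 0) * t ^ i)" for k' t x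
  define y :: "real \<Rightarrow> real Matrix.vec" where "y t = Matrix.vec 1 (\<lambda>_. t ^ Suc i / real (Suc i))" for t
  define \<beta> where "\<beta> = (\<Sum>j<stages M. bcoef M k $ j * cvec M $ j ^ i)"
  have sumF: "(\<Sum>k'\<in>{1..parts M}. F k' t x $ 0) = t ^ i" for t x
    using k by (simp add: F_def if_distrib[of "\<lambda>z. z * _"] cong: if_cong)
  have dy: "has_vec_deriv 1 y (Matrix.vec 1 (\<lambda>l. \<Sum>k'\<in>{1..parts M}. F k' t (y t) $ l)) t {0..0 + 1}" for t
  proof -
    have "((\<lambda>\<tau>. \<tau> ^ Suc i / real (Suc i)) has_real_derivative t ^ i) (at t within {0..0 + 1})"
      by (auto intro!: derivative_eq_intros simp del: power_Suc of_nat_Suc)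
    then show ?thesis using sumF by (simp add: has_vec_deriv_def y_def del: power_Suc of_nat_Suc)
  qed
  have "smooth_fn 1 (\<lambda>t x. F k' t x $ l)" if "l < 1" for k' l
    using smooth_fn_monomial[of 1 "if k' = k then 1 else 0" i] that by (simp add: F_def)
  then have "\<exists>C. \<exists>\<delta>>0. \<forall>dt V y'. 0 < dt \<and> dt \<le> \<delta> \<and> dt \<le> 1 \<and> prk_step M 1 F 0 dt (y 0) V y'
            \<longrightarrow> linf_norm (y (0 + dt) - y') \<le> C * dt ^ (p + 1)"
    using dy by (intro p[unfolded classical_order_def, rule_format]) (auto simp: F_def)
  then obtain C \<delta> where \<delta>: "\<delta> > 0" and C: "\<And>dt V y'. 0 < dt \<Longrightarrow> dt \<le> \<delta> \<Longrightarrow> dt \<le> 1 \<Longrightarrow>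
      prk_step M 1 F 0 dt (y 0) V y' \<Longrightarrow> linf_norm (y (0 + dt) - y') \<le> C * dt ^ (p + 1)"
    by blast
  have bound: "\<bar>1 / real (Suc i) - \<beta>\<bar> \<le> \<bar>C\<bar> * dt" if dt: "0 < dt" "dt \<le> \<delta>" "dt \<le> 1" for dt
  proof -
    \<comment> \<open>As F ignores the state, a step can be written down outright; the zero vector
      is a dummy argument in place of the stage values.\<close>
    define V where "V i' = Matrix.vec 1 (\<lambda>l. y 0 $ l + dt * (\<Sum>k\<in>{1..parts M}. \<Sum>j<stages M.
        Acoef M k $$ (i', j) * F k (0 + cvec M $ j * dt) (0\<^sub>v 1) $ l))" for i'
    define y' where "y' = Matrix.vec 1 (\<lambda>l. y 0 $ l + dt * (\<Sum>k\<in>{1..parts M}. \<Sum>j<stages M.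
        bcoef M k $ j * F k (0 + cvec M $ j * dt) (0\<^sub>v 1) $ l))"
    have F_indep: "F k' t x = F k' t (0\<^sub>v 1)" for k' t x by (simp add: F_def)
    have "prk_step M 1 F 0 dt (y 0) V y'"
      unfolding prk_step_def F_indep[of _ _ "V _"] by (auto simp: V_def y'_def y_def)
    then have le: "linf_norm (y dt - y') \<le> C * dt ^ (p + 1)" using C dt by fastforce
    have "(\<Sum>k'\<in>{1..parts M}. \<Sum>j<stages M. bcoef M k' $ j * F k' (0 + cvec M $ j * dt) (0\<^sub>v 1) $ 0)
        = (\<Sum>k'\<in>{1..parts M}. if k' = k then dt ^ i * \<beta> else 0)"
      by (intro sum.cong) (auto simp: F_def \<beta>_def sum_distrib_left power_mult_distrib algebra_simps)
    then have "(y dt - y') $ 0 = dt ^ Suc i * (1 / real (Suc i) - \<beta>)"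
      using k by (simp add: y_def y'_def algebra_simps)
    then have "\<bar>(y dt - y') $ 0\<bar> = dt ^ Suc i * \<bar>1 / real (Suc i) - \<beta>\<bar>"
      using dt by (simp add: abs_mult del: power_Suc of_nat_Suc)
    moreover have "\<bar>(y dt - y') $ 0\<bar> \<le> linf_norm (y dt - y')"
      by (rule abs_index_le_linf_norm) (simp add: y'_def)
    moreover have "C * dt ^ (p + 1) \<le> \<bar>C\<bar> * dt ^ (p + 1)"
      using dt by (intro mult_right_mono) auto
    ultimately have "dt ^ Suc i * \<bar>1 / real (Suc i) - \<beta>\<bar> \<le> \<bar>C\<bar> * dt ^ (p + 1)"
      using le by linarith
    \<comment> \<open>Here i < p enters; lowering the exponent needs dt \<le> 1.\<close>
    also have "\<dots> \<le> \<bar>C\<bar> * dt ^ (Suc i + 1)"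
      using dt i by (intro mult_left_mono power_decreasing) auto
    also have "\<dots> = dt ^ Suc i * (\<bar>C\<bar> * dt)" by simp
    finally show ?thesis using dt by (subst (asm) mult_le_cancel_left_pos) auto
  qed
  have "1 / real (Suc i) - \<beta> = 0"
  proof (rule ccontr)
    define e where "e = \<bar>1 / real (Suc i) - \<beta>\<bar>"
    assume "1 / real (Suc i) - \<beta> \<noteq> 0"
    then have e: "e > 0" by (simp add: e_def)
    \<comment> \<open>Small enough for |C| dt to be at most e / 2; adding 1 to |C| avoids a zero
      denominator.\<close>
    define dt where "dt = min (min \<delta> 1) (e / (2 * (\<bar>C\<bar> + 1)))"
    have dt: "0 < dt" "dt \<le> \<delta>" "dt \<le> 1" using \<delta> e by (auto simp: dt_def intro!: divide_pos_pos)
    have "e \<le> \<bar>C\<bar> * dt" using bound[OF dt] by (simp add: e_def)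
    also have "\<dots> \<le> \<bar>C\<bar> * (e / (2 * (\<bar>C\<bar> + 1)))" by (intro mult_left_mono) (auto simp: dt_def)
    also have "\<dots> \<le> e / 2" using e by (simp add: field_simps)
    finally show False using e by simp
  qed
  then show ?thesis by (simp add: \<beta>_def)
qed

section \<open>The stability matrices of explicit methods\<close>

text \<open>The Z k are arbitrary matrices with a common bound, not necessarily small. The constants
  derived here depend on the method and on \<open>c\<close> alone, hence neither on mesh nor on step
  size.\<close>

locale explicit_linear_prk =
  fixes M :: prk and m :: nat and Z :: "nat \<Rightarrow> real mat" and c :: real
  assumes is_prk: "prk_method M" and explicit: "explicit_prk M"
    and Z_carrier: "\<And>k. k \<in> {1..parts M} \<Longrightarrow> Z k \<in> carrier_mat m m"
    and Z_bound: "\<And>k. k \<in> {1..parts M} \<Longrightarrow> linf_opnorm (Z k) \<le> c"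
begin

abbreviation "s \<equiv> stages M"
abbreviation "K \<equiv> {1..parts M}"

lemma Acoef_carrier: "k \<in> K \<Longrightarrow> Acoef M k \<in> carrier_mat s s"
  and bcoef_carrier: "k \<in> K \<Longrightarrow> bcoef M k \<in> carrier_vec s"
  using is_prk by (auto simp: prk_method_def)

lemma c_nonneg: "0 \<le> c"
  using is_prk Z_bound[of 1] linf_opnorm_nonneg[of "Z 1"] by (auto simp: prk_method_def)

definition stage_mat :: "real mat" where
  "stage_mat = mat_sum (m * s) (m * s) (\<lambda>k. kron (Acoef M k) (1\<^sub>m m) * kron (1\<^sub>m s) (Z k)) K"

definition output_mat :: "real mat" where
  "output_mat = mat_sum m (m * s) (\<lambda>k. kron_row m (bcoef M k) * kron (1\<^sub>m s) (Z k)) K"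

definition stage_const :: real where
  "stage_const = c * (\<Sum>k\<in>K. \<Sum>i<s. \<Sum>j<s. \<bar>Acoef M k $$ (i, j)\<bar>)"

definition output_const :: real where
  "output_const = c * (\<Sum>k\<in>K. \<Sum>j<s. \<bar>bcoef M k $ j\<bar>)"

lemma stage_mat_carrier [simp]: "stage_mat \<in> carrier_mat (m * s) (m * s)"
  by (simp add: stage_mat_def)

lemma output_mat_carrier [simp]: "output_mat \<in> carrier_mat m (m * s)"
  by (simp add: output_mat_def)

lemma stage_const_nonneg: "0 \<le> stage_const" and output_const_nonneg: "0 \<le> output_const"
  using c_nonneg by (auto simp: stage_const_def output_const_def intro!: mult_nonneg_nonneg sum_nonneg)

lemma Z_norm: "k \<in> K \<Longrightarrow> v \<in> carrier_vec m \<Longrightarrow> l < m \<Longrightarrow> \<bar>(Z k *\<^sub>v v) $ l\<bar> \<le> c * linf_norm v"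
  using abs_index_le_linf_norm[of l "Z k *\<^sub>v v"] linf_norm_mult_mat_vec_le[OF Z_carrier _ Z_bound, of k v]
    Z_carrier[of k] by (auto simp del: index_mult_mat_vec)

lemma stage_mat_stack:
  assumes y: "\<And>j. j < s \<Longrightarrow> y j \<in> carrier_vec m"
  shows "stage_mat *\<^sub>v stack m s y
    = stack m s (\<lambda>i. vec m (\<lambda>l. \<Sum>k\<in>K. \<Sum>j<s. Acoef M k $$ (i, j) * (Z k *\<^sub>v y j) $ l))"
proof -
  have car: "kron (Acoef M k) (1\<^sub>m m) \<in> carrier_mat (m * s) (m * s)"
    "kron (1\<^sub>m s) (Z k) \<in> carrier_mat (m * s) (m * s)" if "k \<in> K" for k
    using that by (auto intro!: kron_carrier Acoef_carrier Z_carrier)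
  have "stage_mat *\<^sub>v stack m s y
      = vsum (m * s) (\<lambda>k. (kron (Acoef M k) (1\<^sub>m m) * kron (1\<^sub>m s) (Z k)) *\<^sub>v stack m s y) K"
    unfolding stage_mat_def by (rule mat_sum_mult_vec[OF mult_carrier_mat[OF car] stack_carrier])
  also have "\<dots> = vsum (m * s) (\<lambda>k. stack m s (\<lambda>i. vec m (\<lambda>l. \<Sum>j<s. Acoef M k $$ (i, j) * (Z k *\<^sub>v y j) $ l))) K"
  proof -
    have "(kron (Acoef M k) (1\<^sub>m m) * kron (1\<^sub>m s) (Z k)) *\<^sub>v stack m s y
        = stack m s (\<lambda>i. vec m (\<lambda>l. \<Sum>j<s. Acoef M k $$ (i, j) * (Z k *\<^sub>v y j) $ l))" if k: "k \<in> K" for k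
    proof -
      have "(kron (Acoef M k) (1\<^sub>m m) * kron (1\<^sub>m s) (Z k)) *\<^sub>v stack m s y
          = kron (Acoef M k) (1\<^sub>m m) *\<^sub>v (kron (1\<^sub>m s) (Z k) *\<^sub>v stack m s y)"
        using car[OF k] by (intro assoc_mult_mat_vec) auto
      also have "\<dots> = kron (Acoef M k) (1\<^sub>m m) *\<^sub>v stack m s (\<lambda>j. Z k *\<^sub>v y j)"
        using one_kron_mult_stack[OF Z_carrier[OF k] y] by simp
      also have "\<dots> = stack m s (\<lambda>i. vec m (\<lambda>l. \<Sum>j<s. Acoef M k $$ (i, j) * (Z k *\<^sub>v y j) $ l))"
        using y Z_carrier[OF k] by (intro kron_one_mult_stack[OF Acoef_carrier[OF k]]) auto
      finally show ?thesis .
    qed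
    then show ?thesis by (simp add: vsum_def del: index_mult_mat_vec)
  qed
  finally show ?thesis
    by (simp add: vsum_def stack_def) (rule eq_vecI, auto simp: div_mod_less simp del: index_mult_mat_vec)
qed

lemma output_mat_stack:
  assumes y: "\<And>j. j < s \<Longrightarrow> y j \<in> carrier_vec m"
  shows "output_mat *\<^sub>v stack m s y = vec m (\<lambda>l. \<Sum>k\<in>K. \<Sum>j<s. bcoef M k $ j * (Z k *\<^sub>v y j) $ l)"
proof -
  have car: "kron_row m (bcoef M k) \<in> carrier_mat m (m * s)"
    "kron (1\<^sub>m s) (Z k) \<in> carrier_mat (m * s) (m * s)" if "k \<in> K" for k
    using that by (auto intro!: kron_carrier kron_row_carrier bcoef_carrier Z_carrier)
  have "output_mat *\<^sub>v stack m s y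
      = vsum m (\<lambda>k. (kron_row m (bcoef M k) * kron (1\<^sub>m s) (Z k)) *\<^sub>v stack m s y) K"
    unfolding output_mat_def by (rule mat_sum_mult_vec[OF mult_carrier_mat[OF car] stack_carrier])
  also have "\<dots> = vsum m (\<lambda>k. vec m (\<lambda>l. \<Sum>j<s. bcoef M k $ j * (Z k *\<^sub>v y j) $ l)) K"
  proof -
    have "(kron_row m (bcoef M k) * kron (1\<^sub>m s) (Z k)) *\<^sub>v stack m s y
        = vec m (\<lambda>l. \<Sum>j<s. bcoef M k $ j * (Z k *\<^sub>v y j) $ l)" if k: "k \<in> K" for k
    proof -
      have "(kron_row m (bcoef M k) * kron (1\<^sub>m s) (Z k)) *\<^sub>v stack m s y
          = kron_row m (bcoef M k) *\<^sub>v (kron (1\<^sub>m s) (Z k) *\<^sub>v stack m s y)"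
        using car[OF k] by (intro assoc_mult_mat_vec) auto
      also have "\<dots> = kron_row m (bcoef M k) *\<^sub>v stack m s (\<lambda>j. Z k *\<^sub>v y j)"
        using one_kron_mult_stack[OF Z_carrier[OF k] y] by simp
      also have "\<dots> = vec m (\<lambda>l. \<Sum>j<s. bcoef M k $ j * (Z k *\<^sub>v y j) $ l)"
        using y Z_carrier[OF k] by (intro kron_row_mult_stack[OF bcoef_carrier[OF k]]) auto
      finally show ?thesis .
    qed
    then show ?thesis by (simp add: vsum_def del: index_mult_mat_vec)
  qed
  finally show ?thesis
    by (simp add: vsum_def) (rule eq_vecI, auto simp del: index_mult_mat_vec)
qed

lemma output_mat_norm:
  assumes y: "y \<in> carrier_vec (m * s)"
  shows "linf_norm (output_mat *\<^sub>v y) \<le> output_const * linf_norm y"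
proof (rule linf_norm_leI)
  show "0 \<le> output_const * linf_norm y" using output_const_nonneg linf_norm_nonneg by simp
next
  fix l assume "l < dim_vec (output_mat *\<^sub>v y)"
  then have l: "l < m" using output_mat_carrier by (auto simp del: output_mat_carrier)
  define z where "z i = vec m (\<lambda>l. y $ (i * m + l))" for i
  have z: "z i \<in> carrier_vec m" for i by (simp add: z_def)
  have yz: "y = stack m s z" using stack_blocks[OF y] by (simp add: z_def[abs_def])
  have "\<bar>(output_mat *\<^sub>v y) $ l\<bar> = \<bar>\<Sum>k\<in>K. \<Sum>j<s. bcoef M k $ j * (Z k *\<^sub>v z j) $ l\<bar>"
    using l output_mat_stack[OF z] by (simp add: yz del: index_mult_mat_vec)
  also have "\<dots> \<le> (\<Sum>k\<in>K. \<Sum>j<s. \<bar>bcoef M k $ j\<bar> * (c * linf_norm y))"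
  proof (rule order_trans[OF sum_abs], rule sum_mono, rule order_trans[OF sum_abs], rule sum_mono)
    fix k j assume kj: "k \<in> K" "j \<in> {..<s}"
    have "\<bar>(Z k *\<^sub>v z j) $ l\<bar> \<le> c * linf_norm (z j)" by (rule Z_norm[OF kj(1) z l])
    also have "\<dots> \<le> c * linf_norm y"
      using kj(2) linf_norm_block_le[of j s z m] z c_nonneg by (intro mult_left_mono) (auto simp: yz)
    finally show "\<bar>bcoef M k $ j * (Z k *\<^sub>v z j) $ l\<bar> \<le> \<bar>bcoef M k $ j\<bar> * (c * linf_norm y)"
      unfolding abs_mult by (rule mult_left_mono) simp
  qed
  also have "\<dots> = output_const * linf_norm y"
    by (simp add: output_const_def sum_distrib_left sum_distrib_right algebra_simps)
  finally show "\<bar>(output_mat *\<^sub>v y) $ l\<bar> \<le> output_const * linf_norm y" .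
qed

text \<open>Explicitness makes the stage system block triangular, so the blocks are estimated one after
  the other. Besides the bound on the inverse, this estimate also yields the invertibility.\<close>

lemma stage_system_bound:
  assumes y: "y \<in> carrier_vec (m * s)"
  shows "linf_norm y \<le> (1 + stage_const) ^ s * linf_norm ((1\<^sub>m (m * s) - stage_mat) *\<^sub>v y)"
proof -
  define x where "x = (1\<^sub>m (m * s) - stage_mat) *\<^sub>v y"
  define z where "z i = vec m (\<lambda>l. y $ (i * m + l))" for i
  have z: "z i \<in> carrier_vec m" for i by (simp add: z_def)
  have yz: "y = stack m s z" using stack_blocks[OF y] by (simp add: z_def[abs_def])
  have xeq: "x = y - stage_mat *\<^sub>v y"
    unfolding x_def using y by (subst minus_mult_distrib_mat_vec[OF one_carrier_mat stage_mat_carrier y]) auto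
  have xc: "x \<in> carrier_vec (m * s)"
    unfolding xeq using y by (intro minus_carrier_vec mult_mat_vec_carrier[OF stage_mat_carrier])
  have block: "z i $ l = x $ (i * m + l) + (\<Sum>k\<in>K. \<Sum>j<s. Acoef M k $$ (i, j) * (Z k *\<^sub>v z j) $ l)"
    if "i < s" "l < m" for i l
  proof -
    have p: "i * m + l < m * s" using block_index_less that by simp
    then have "x $ (i * m + l) = y $ (i * m + l) - (stage_mat *\<^sub>v y) $ (i * m + l)"
      using carrier_matD[OF stage_mat_carrier] y unfolding xeq by (simp del: index_mult_mat_vec)
    then show ?thesis
      using that stage_mat_stack[OF z] by (simp add: yz stack_index del: index_mult_mat_vec)
  qed
  have bound: "i < s \<Longrightarrow> linf_norm (z i) \<le> (1 + stage_const) ^ Suc i * linf_norm x" for i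
  proof (induction i rule: less_induct)
    case (less i)
    \<comment> \<open>D dominates x and all earlier blocks because 1 + \<open>stage_const\<close>
      \<ge> 1. The next block is then at most (1 + \<open>stage_const\<close>) D: a discrete
      Gronwall argument over the stages.\<close>
    define D where "D = (1 + stage_const) ^ i * linf_norm x"
    have D: "linf_norm x \<le> D"
      using stage_const_nonneg linf_norm_nonneg[of x] mult_right_mono[of 1 "(1 + stage_const) ^ i" "linf_norm x"]
      by (simp add: D_def one_le_power)
    have D0: "0 \<le> D" using D linf_norm_nonneg[of x] by linarith
    have zD: "linf_norm (z j) \<le> D" if "j < i" for j
    proof -
      have "linf_norm (z j) \<le> (1 + stage_const) ^ Suc j * linf_norm x"
        using less that by simp
      also have "\<dots> \<le> D" unfolding D_def using that stage_const_nonneg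
        by (intro mult_right_mono power_increasing linf_norm_nonneg) auto
      finally show ?thesis .
    qed
    have "linf_norm (z i) \<le> D + stage_const * D"
    proof (rule linf_norm_leI)
      show "0 \<le> D + stage_const * D" using D0 stage_const_nonneg by simp
      fix l assume "l < dim_vec (z i)"
      then have l: "l < m" by (simp add: z_def)
      have "\<bar>\<Sum>k\<in>K. \<Sum>j<s. Acoef M k $$ (i, j) * (Z k *\<^sub>v z j) $ l\<bar>
          \<le> (\<Sum>k\<in>K. \<Sum>j<s. \<bar>Acoef M k $$ (i, j)\<bar> * (c * D))"
      proof (rule order_trans[OF sum_abs], rule sum_mono, rule order_trans[OF sum_abs], rule sum_mono)
        fix k j assume kj: "k \<in> K" "j \<in> {..<s}"
        show "\<bar>Acoef M k $$ (i, j) * (Z k *\<^sub>v z j) $ l\<bar> \<le> \<bar>Acoef M k $$ (i, j)\<bar> * (c * D)"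
        proof (cases "j < i")
          case True
          have "\<bar>(Z k *\<^sub>v z j) $ l\<bar> \<le> c * linf_norm (z j)" by (rule Z_norm[OF kj(1) z l])
          also have "\<dots> \<le> c * D" using zD[OF True] c_nonneg by (rule mult_left_mono)
          finally show ?thesis unfolding abs_mult by (rule mult_left_mono) simp
        next
          case False
          then have "Acoef M k $$ (i, j) = 0"
            using kj less.prems explicit by (auto simp: explicit_prk_def)
          then show ?thesis by simp
        qed
      qed
      also have "\<dots> \<le> (\<Sum>k\<in>K. \<Sum>i'<s. \<Sum>j<s. \<bar>Acoef M k $$ (i', j)\<bar> * (c * D))"
        using less.prems c_nonneg D0
        by (intro sum_mono member_le_sum[of i "{..<s}" "\<lambda>i'. \<Sum>j<s. \<bar>Acoef M _ $$ (i', j)\<bar> * (c * D)"])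
          (auto intro!: sum_nonneg)
      also have "\<dots> = stage_const * D"
        by (simp add: stage_const_def sum_distrib_left sum_distrib_right algebra_simps)
      finally have "\<bar>\<Sum>k\<in>K. \<Sum>j<s. Acoef M k $$ (i, j) * (Z k *\<^sub>v z j) $ l\<bar> \<le> stage_const * D" .
      moreover have "\<bar>x $ (i * m + l)\<bar> \<le> D"
        using abs_index_le_linf_norm[of "i * m + l" x] xc block_index_less[OF less.prems l] D by simp
      ultimately show "\<bar>z i $ l\<bar> \<le> D + stage_const * D"
        using block[OF less.prems l] by linarith
    qed
    then show ?case by (simp add: D_def algebra_simps)
  qed
  have "linf_norm (stack m s z) \<le> (1 + stage_const) ^ s * linf_norm x"
  proof (rule linf_norm_stack_le[OF _ z])
    show "0 \<le> (1 + stage_const) ^ s * linf_norm x"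
      using stage_const_nonneg linf_norm_nonneg by simp
    fix i assume i: "i < s"
    have "(1 + stage_const) ^ Suc i * linf_norm x \<le> (1 + stage_const) ^ s * linf_norm x"
      using i stage_const_nonneg by (intro mult_right_mono power_increasing linf_norm_nonneg) auto
    then show "linf_norm (z i) \<le> (1 + stage_const) ^ s * linf_norm x" using bound[OF i] by linarith
  qed
  then show ?thesis by (simp add: yz x_def)
qed

text \<open>\<open>rT\<close> contains \<open>the\<close> applied to \<open>mat_inverse\<close>,
  which is meaningful only once an inverse exists. The stage bound forces a trivial kernel, hence a
  nonzero determinant.\<close>

lemma stage_system_inverse:
  obtains N where "N \<in> carrier_mat (m * s) (m * s)" "rT M m Z = output_mat * N"
    "(1\<^sub>m (m * s) - stage_mat) * N = 1\<^sub>m (m * s)" "N * (1\<^sub>m (m * s) - stage_mat) = 1\<^sub>m (m * s)"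
proof -
  let ?S = "1\<^sub>m (m * s) - stage_mat"
  have S: "?S \<in> carrier_mat (m * s) (m * s)" by (intro minus_carrier_mat) simp
  have "v = 0\<^sub>v (m * s)" if "v \<in> carrier_vec (m * s)" "?S *\<^sub>v v = 0\<^sub>v (m * s)" for v
    using stage_system_bound[OF that(1)] that by (simp add: linf_norm_zero linf_norm_eq_0D)
  then have "det ?S \<noteq> 0" using det_0_iff_vec_prod_zero_field[OF S] by blast
  then have "?S \<in> Units (ring_mat TYPE(real) (m * s) ())" by (rule det_non_zero_imp_unit[OF S])
  then obtain N where N: "mat_inverse ?S = Some N"
    using mat_inverse(1)[OF S, of "()"] by (cases "mat_inverse ?S") auto
  then have "rT M m Z = output_mat * N"
    by (simp add: rT_def Let_def output_mat_def stage_mat_def)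
  then show ?thesis using mat_inverse(2)[OF S N] that by blast
qed

lemma rT_carrier [simp]: "rT M m Z \<in> carrier_mat m (m * s)"
  by (rule stage_system_inverse) (simp add: mult_carrier_mat[OF output_mat_carrier])

text \<open>Multiplying \<open>rT\<close> by the matrix it inverts leaves \<open>output_mat\<close>.
  In this form the stage errors can be eliminated: only the right-hand side of their linear system
  has to be known.\<close>

lemma rT_mult_vec:
  assumes y: "y \<in> carrier_vec (m * s)"
  shows "rT M m Z *\<^sub>v (y - stage_mat *\<^sub>v y) = output_mat *\<^sub>v y"
proof -
  obtain N where N: "N \<in> carrier_mat (m * s) (m * s)" "rT M m Z = output_mat * N"
    "N * (1\<^sub>m (m * s) - stage_mat) = 1\<^sub>m (m * s)"
    by (rule stage_system_inverse)
  have S: "1\<^sub>m (m * s) - stage_mat \<in> carrier_mat (m * s) (m * s)" by (intro minus_carrier_mat) simp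
  have "y - stage_mat *\<^sub>v y = (1\<^sub>m (m * s) - stage_mat) *\<^sub>v y"
    using y by (subst minus_mult_distrib_mat_vec[OF one_carrier_mat stage_mat_carrier y]) auto
  moreover have "N *\<^sub>v ((1\<^sub>m (m * s) - stage_mat) *\<^sub>v y) = y"
    using assoc_mult_mat_vec[OF N(1) S y] y by (simp add: N(3))
  ultimately show ?thesis
    using assoc_mult_mat_vec[OF output_mat_carrier N(1)] mult_mat_vec_carrier[OF S y] by (simp add: N(2))
qed

text \<open>The inverse applied to x solves the stage system with right-hand side x, so the stage
  bound controls it. Stage remainders thus keep their order in dt on the way to the output,
  uniformly in the mesh.\<close>

lemma rT_norm:
  assumes x: "x \<in> carrier_vec (m * s)"
  shows "linf_norm (rT M m Z *\<^sub>v x) \<le> output_const * (1 + stage_const) ^ s * linf_norm x"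
proof -
  obtain N where N: "N \<in> carrier_mat (m * s) (m * s)" "rT M m Z = output_mat * N"
    "(1\<^sub>m (m * s) - stage_mat) * N = 1\<^sub>m (m * s)"
    by (rule stage_system_inverse)
  have S: "1\<^sub>m (m * s) - stage_mat \<in> carrier_mat (m * s) (m * s)" by (intro minus_carrier_mat) simp
  have Nx: "N *\<^sub>v x \<in> carrier_vec (m * s)" using N(1) x by simp
  have "(1\<^sub>m (m * s) - stage_mat) *\<^sub>v (N *\<^sub>v x) = x"
    using assoc_mult_mat_vec[OF S N(1) x] x by (simp add: N(3))
  then have "linf_norm (N *\<^sub>v x) \<le> (1 + stage_const) ^ s * linf_norm x"
    using stage_system_bound[OF Nx] by simp
  then have "output_const * linf_norm (N *\<^sub>v x) \<le> output_const * ((1 + stage_const) ^ s * linf_norm x)"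
    using output_const_nonneg by (rule mult_left_mono)
  moreover have "rT M m Z *\<^sub>v x = output_mat *\<^sub>v (N *\<^sub>v x)"
    unfolding N(2) by (rule assoc_mult_mat_vec[OF output_mat_carrier N(1) x])
  ultimately show ?thesis using output_mat_norm[OF Nx] by (simp add: mult.assoc)
qed

lemma evec_carrier [simp]: "evec M \<in> carrier_vec s"
  by (simp add: evec_def)

lemma cpow_carrier [simp]: "cpow M j \<in> carrier_vec s"
  by (simp add: cpow_def)

lemma Rmat_carrier [simp]: "Rmat M m Z \<in> carrier_mat m m"
  unfolding Rmat_def by (intro add_carrier_mat mult_carrier_mat[OF rT_carrier] kron_col_carrier) simp

lemma Rmat_mult_vec:
  assumes x: "x \<in> carrier_vec m"
  shows "Rmat M m Z *\<^sub>v x = x + rT M m Z *\<^sub>v (kron_col m (evec M) *\<^sub>v x)"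
proof -
  have E: "kron_col m (evec M) \<in> carrier_mat (m * s) m" by (intro kron_col_carrier) simp
  show ?thesis
    unfolding Rmat_def add_mult_distrib_mat_vec[OF one_carrier_mat mult_carrier_mat[OF rT_carrier E] x]
      assoc_mult_mat_vec[OF rT_carrier E x]
    using x by simp
qed

text \<open>Entry i of c^j - j A_k c^(j-1); the companion \<open>output_lead\<close> is 1 - j b_k^T
  c^(j-1). They are the scalar contents of the two terms of d_(j,k) and, for j = q + 1, the leading
  coefficients in \<open>taylor_defect\<close>.\<close>

definition stage_lead :: "nat \<Rightarrow> nat \<Rightarrow> nat \<Rightarrow> real" where
  "stage_lead j k i = cvec M $ i ^ j - real j * (\<Sum>i'<s. Acoef M k $$ (i, i') * cvec M $ i' ^ (j - 1))"

definition output_lead :: "nat \<Rightarrow> nat \<Rightarrow> real" where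
  "output_lead j k = 1 - real j * (\<Sum>i<s. bcoef M k $ i * cvec M $ i ^ (j - 1))"

lemma dmat_carrier: "k \<in> K \<Longrightarrow> dmat M m Z j k \<in> carrier_mat m m"
  unfolding dmat_def
  by (intro add_carrier_mat mult_carrier_mat[OF rT_carrier] minus_carrier_mat smult_carrier_mat
      mult_carrier_mat[OF kron_carrier[OF Acoef_carrier one_carrier_mat]] kron_col_carrier cpow_carrier)

text \<open>Apart from \<open>rT\<close>, all Kronecker products in d_(j,k) have an identity as
  second factor, so they scale every component of x alike. This brings the matrix of the theorem
  into the form in which Taylor expansion produces the defects.\<close>

lemma dmat_mult_vec:
  assumes k: "k \<in> K" and x: "x \<in> carrier_vec m"
  shows "dmat M m Z j k *\<^sub>v x = vec m (\<lambda>l. output_lead j k * x $ l)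
    + rT M m Z *\<^sub>v stack m s (\<lambda>i. vec m (\<lambda>l. stage_lead j k i * x $ l))"
proof -
  define C where "C = kron_col m (cpow M (j - 1))"
  define C' where "C' = kron_col m (cpow M j)"
  define A where "A = kron (Acoef M k) (1\<^sub>m m)"
  define b where "b = kron_row m (bcoef M k)"
  have car: "C \<in> carrier_mat (m * s) m" "C' \<in> carrier_mat (m * s) m"
    "A \<in> carrier_mat (m * s) (m * s)" "b \<in> carrier_mat m (m * s)"
    using kron_carrier[OF Acoef_carrier[OF k] one_carrier_mat, of m] bcoef_carrier[OF k]
    by (auto simp: C_def C'_def A_def b_def intro!: kron_col_carrier kron_row_carrier)
  have AC: "A * C \<in> carrier_mat (m * s) m" and bC: "b * C \<in> carrier_mat m m"
    using car by auto
  have c1: "real j \<cdot>\<^sub>m (b * C) \<in> carrier_mat m m" "real j \<cdot>\<^sub>m (A * C) \<in> carrier_mat (m * s) m"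
    using AC bC by (auto intro: smult_carrier_mat)
  have c2: "1\<^sub>m m - real j \<cdot>\<^sub>m (b * C) \<in> carrier_mat m m" "C' - real j \<cdot>\<^sub>m (A * C) \<in> carrier_mat (m * s) m"
    using c1 by (auto intro!: minus_carrier_mat)
  have Cx: "C *\<^sub>v x = stack m s (\<lambda>i. cpow M (j - 1) $ i \<cdot>\<^sub>v x)"
    "C' *\<^sub>v x = stack m s (\<lambda>i. cpow M j $ i \<cdot>\<^sub>v x)"
    unfolding C_def C'_def by (intro kron_col_mult_vec x cpow_carrier)+
  have "(b * C) *\<^sub>v x = vec m (\<lambda>l. \<Sum>i<s. bcoef M k $ i * (cpow M (j - 1) $ i \<cdot>\<^sub>v x) $ l)"
    unfolding assoc_mult_mat_vec[OF car(4,1) x] Cx unfolding b_def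
    using x by (intro kron_row_mult_stack bcoef_carrier k) auto
  then have out: "(1\<^sub>m m - real j \<cdot>\<^sub>m (b * C)) *\<^sub>v x = vec m (\<lambda>l. output_lead j k * x $ l)"
    unfolding minus_mult_distrib_mat_vec[OF one_carrier_mat c1(1) x] smult_mat_mult_vec[OF bC x]
    using x by (intro eq_vecI)
      (auto simp: output_lead_def cpow_def left_diff_distrib sum_distrib_right mult.assoc)
  have "(A * C) *\<^sub>v x = stack m s (\<lambda>i. vec m (\<lambda>l. \<Sum>i'<s. Acoef M k $$ (i, i') * (cpow M (j - 1) $ i' \<cdot>\<^sub>v x) $ l))"
    unfolding assoc_mult_mat_vec[OF car(3,1) x] Cx unfolding A_def
    using x by (intro kron_one_mult_stack Acoef_carrier k) auto
  then have st: "(C' - real j \<cdot>\<^sub>m (A * C)) *\<^sub>v x = stack m s (\<lambda>i. vec m (\<lambda>l. stage_lead j k i * x $ l))"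
    unfolding minus_mult_distrib_mat_vec[OF car(2) c1(2) x] smult_mat_mult_vec[OF AC x] Cx
    using x by (intro eq_vecI)
      (auto simp: stage_lead_def stack_def div_mod_less cpow_def left_diff_distrib sum_distrib_right mult.assoc)
  have "dmat M m Z j k *\<^sub>v x = (1\<^sub>m m - real j \<cdot>\<^sub>m (b * C)) *\<^sub>v x
      + rT M m Z *\<^sub>v ((C' - real j \<cdot>\<^sub>m (A * C)) *\<^sub>v x)"
    unfolding dmat_def C_def[symmetric] C'_def[symmetric] A_def[symmetric] b_def[symmetric]
      add_mult_distrib_mat_vec[OF c2(1) mult_carrier_mat[OF rT_carrier c2(2)] x]
      assoc_mult_mat_vec[OF rT_carrier c2(2) x] ..
  then show ?thesis by (simp only: out st)
qed

end

text \<open>The extra power R^j is what makes the induction work. An induction on v n alone would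
  pay a factor K in every step and end with K^n; with R^j in front, each R is absorbed into the
  power, and every perturbation meets one power of R and one factor K.\<close>

lemma perturbed_power_bound:
  assumes R: "R \<in> carrier_mat m m" and Kb: "\<And>j. linf_opnorm (R ^\<^sub>m j) \<le> K"
    and v: "\<And>n. n \<le> N \<Longrightarrow> v n \<in> carrier_vec m"
    and \<zeta>: "\<And>n. n < N \<Longrightarrow> \<zeta> n \<in> carrier_vec m" "\<And>n. n < N \<Longrightarrow> linf_norm (\<zeta> n) \<le> z"
    and step: "\<And>n. n < N \<Longrightarrow> v (Suc n) = R *\<^sub>v v n + \<zeta> n"
    and n: "n \<le> N"
  shows "linf_norm (R ^\<^sub>m j *\<^sub>v v n) \<le> K * linf_norm (v 0) + real n * (K * z)"
  using n
proof (induction n arbitrary: j)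
  case 0
  show ?case
    using linf_norm_mult_mat_vec_le[OF pow_carrier_mat[OF R] v Kb, of 0 j] 0 by simp
next
  case (Suc n)
  then have n: "n < N" by simp
  have K: "0 \<le> K" using Kb[of 0] linf_opnorm_nonneg[of "R ^\<^sub>m 0"] by linarith
  note Rj = pow_carrier_mat[OF R, of j]
  have Rv: "R *\<^sub>v v n \<in> carrier_vec m" using R v n by simp
  have eq: "R ^\<^sub>m j *\<^sub>v v (Suc n) = R ^\<^sub>m Suc j *\<^sub>v v n + R ^\<^sub>m j *\<^sub>v \<zeta> n"
    unfolding step[OF n] mult_add_distrib_mat_vec[OF Rj Rv \<zeta>(1)[OF n]]
    using assoc_mult_mat_vec[OF Rj R v, of n] n by simp
  have "linf_norm (R ^\<^sub>m j *\<^sub>v v (Suc n)) \<le> linf_norm (R ^\<^sub>m Suc j *\<^sub>v v n) + linf_norm (R ^\<^sub>m j *\<^sub>v \<zeta> n)"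
    unfolding eq using v \<zeta>(1)[OF n] n
    by (intro linf_norm_triangle[of _ m] mult_mat_vec_carrier[OF pow_carrier_mat[OF R]]) auto
  also have "linf_norm (R ^\<^sub>m Suc j *\<^sub>v v n) \<le> K * linf_norm (v 0) + real n * (K * z)"
    using Suc.IH[of "Suc j"] n by (simp del: pow_mat.simps)
  also have "linf_norm (R ^\<^sub>m j *\<^sub>v \<zeta> n) \<le> K * z"
    using linf_norm_mult_mat_vec_le[OF Rj \<zeta>(1)[OF n] Kb] mult_left_mono[OF \<zeta>(2)[OF n] K] by linarith
  finally show ?case by (simp add: algebra_simps)
qed

section \<open>Cell-based splittings\<close>

text \<open>A single member of the family: P, dt and D belong to it, whereas the method, q, T, CZ
  and B are shared. Classical order appears as \<open>quadrature\<close>, which involves no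
  derivatives of F.\<close>

locale cell_split_problem =
  fixes M :: prk and P :: semidiscrete and dt T CZ :: real and q :: nat
    and D :: "nat \<Rightarrow> real \<Rightarrow> real vec" and B :: "nat \<Rightarrow> real"
  assumes is_prk': "prk_method M" and explicit': "explicit_prk M" and stage_order: "stage_order M q"
    and quadrature: "\<And>k i. k \<in> {1..parts M} \<Longrightarrow> i < q \<Longrightarrow>
      (\<Sum>j<stages M. bcoef M k $ j * cvec M $ j ^ i) = 1 / real (Suc i)"
    and dt: "dt > 0" and T: "T > 0"
    and system: "semidiscrete_system (parts M) P" and time_points: "time_points_in M T dt (times P)"
    and Z_bounded: "\<And>k. k \<in> {1..parts M} \<Longrightarrow> linf_opnorm (Zmat P dt k) \<le> CZ"
    and derivs: "exact_derivs P D"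
    and deriv_bound: "\<And>i t. 1 \<le> i \<Longrightarrow> t \<in> times P \<Longrightarrow> linf_norm (D i t) \<le> B i"
begin

abbreviation "m \<equiv> dim P"

lemma Lmat_carrier [simp]: "Lmat P \<in> carrier_mat m m"
  using system by (simp add: semidiscrete_system_def)

lemma cell_mat_carrier [simp]: "cell_mat P k \<in> carrier_mat m m"
  by (simp add: cell_mat_def)

lemma Zmat_carrier [simp]: "Zmat P dt k \<in> carrier_mat m m"
  unfolding Zmat_def by (intro smult_carrier_mat mult_carrier_mat[OF cell_mat_carrier Lmat_carrier])

sublocale explicit_linear_prk M m "Zmat P dt" CZ
  by unfold_locales (use is_prk' explicit' Z_bounded in auto)

lemma convex_times: "convex (times P)"
  using system unfolding is_interval_convex_1[symmetric] is_interval_1 semidiscrete_system_def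
  by (meson atLeastAtMost_iff subsetD)

lemma interval_times: "{0..T} \<subseteq> times P"
  using time_points by (simp add: time_points_in_def)

text \<open>Derivatives within \<open>times P\<close> are unique only at limit points. As T > 0,
  this interval contains two points and therefore has no isolated ones.\<close>

lemma times_nontrivial:
  assumes "t \<in> times P"
  shows "at t within times P \<noteq> bot"
proof -
  have "0 \<in> times P" "T \<in> times P" using interval_times T by auto
  then have "times P \<noteq> {x}" for x using T by force
  then have "t islimpt times P"
    using connected_imp_perfect[OF convex_connected[OF convex_times] assms] by blast
  then show ?thesis by (simp add: trivial_limit_within)
qed

lemma D_carrier: "t \<in> times P \<Longrightarrow> D i t \<in> carrier_vec m"
  and D_deriv: "t \<in> times P \<Longrightarrow> l < m \<Longrightarrow>
    ((\<lambda>\<tau>. D i \<tau> $ l) has_real_derivative D (Suc i) t $ l) (at t within times P)"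
  using derivs unfolding exact_derivs_def has_vec_deriv_def by blast+

lemma D_0: "t \<in> times P \<Longrightarrow> D 0 t = exact P t"
  using derivs by (simp add: exact_derivs_def)

lemma exact_carrier: "t \<in> times P \<Longrightarrow> exact P t \<in> carrier_vec m"
  using D_carrier[of t 0] D_0 by simp

lemma source_carrier: "t \<in> times P \<Longrightarrow> source P t \<in> carrier_vec m"
  using system by (simp add: semidiscrete_system_def)

text \<open>Uniqueness of derivatives identifies u' as given by the system with the first of the
  bounded derivatives. This is how F, and with it L, leaves the Taylor expansion.\<close>

lemma D_1_eq_rhs:
  assumes t: "t \<in> times P" and l: "l < m"
  shows "D 1 t $ l = rhs P t (exact P t) $ l"
proof (rule has_field_derivative_unique[OF _ _ times_nontrivial[OF t]])
  show "((\<lambda>\<tau>. exact P \<tau> $ l) has_real_derivative rhs P t (exact P t) $ l) (at t within times P)"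
    using system t l by (auto simp: semidiscrete_system_def has_vec_deriv_def)
  show "((\<lambda>\<tau>. exact P \<tau> $ l) has_real_derivative D 1 t $ l) (at t within times P)"
    by (rule has_field_derivative_transform_within[where d = 1 and f = "\<lambda>\<tau>. D 0 \<tau> $ l"])
      (use D_deriv[OF t l, of 0] D_0 t in auto)
qed

text \<open>The partition makes the choice unique; component l is advanced with the coefficients of
  \<open>part l\<close>.\<close>

definition part :: "nat \<Rightarrow> nat" where
  "part l = (SOME k. k \<in> K \<and> l \<in> cells P k)"

lemma part_mem: "l < m \<Longrightarrow> part l \<in> K" "l < m \<Longrightarrow> l \<in> cells P (part l)"
proof -
  assume "l < m"
  then have "l \<in> (\<Union>k\<in>K. cells P k)"
    using system by (simp add: semidiscrete_system_def)
  then have "\<exists>k. k \<in> K \<and> l \<in> cells P k" by blast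
  then have "part l \<in> K \<and> l \<in> cells P (part l)" unfolding part_def by (rule someI_ex)
  then show "part l \<in> K" "l \<in> cells P (part l)" by auto
qed

lemma mem_cells_iff: "k \<in> K \<Longrightarrow> l < m \<Longrightarrow> l \<in> cells P k \<longleftrightarrow> k = part l"
  using system part_mem[of l] unfolding semidiscrete_system_def disjoint_family_on_def by blast

text \<open>A component lies in one cell set only, so one term of the sum survives. Hence each
  component of the exact solution can be expanded as if for an unpartitioned method.\<close>

lemma sum_cells:
  assumes l: "l < m"
  shows "(\<Sum>k\<in>K. g k * (if l \<in> cells P k then a else 0)) = g (part l) * (a :: real)"
proof -
  have "(\<Sum>k\<in>K. g k * (if l \<in> cells P k then a else 0)) = (\<Sum>k\<in>K. if k = part l then g k * a else 0)"
    by (rule sum.cong) (use l in \<open>auto simp: mem_cells_iff\<close>)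
  then show ?thesis using part_mem(1)[OF l] by simp
qed

lemma cell_mat_mult_index:
  "x \<in> carrier_vec m \<Longrightarrow> l < m \<Longrightarrow> (cell_mat P k *\<^sub>v x) $ l = (if l \<in> cells P k then x $ l else 0)"
  unfolding mult_mat_vec_index[OF cell_mat_carrier]
  by (simp add: cell_mat_def mat_diag_def if_distrib[of "\<lambda>z. z * _"] cong: if_cong)

lemma rhs_carrier: "t \<in> times P \<Longrightarrow> v \<in> carrier_vec m \<Longrightarrow> rhs P t v \<in> carrier_vec m"
  unfolding rhs_def by (intro add_carrier_vec mult_mat_vec_carrier[OF Lmat_carrier] source_carrier)

lemma rhs_part_index: "t \<in> times P \<Longrightarrow> v \<in> carrier_vec m \<Longrightarrow> l < m \<Longrightarrow>
    rhs_part P k t v $ l = (if l \<in> cells P k then rhs P t v $ l else 0)"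
  unfolding rhs_part_def by (rule cell_mat_mult_index[OF rhs_carrier])

lemma rhs_part_exact: "t \<in> times P \<Longrightarrow> l < m \<Longrightarrow>
    rhs_part P k t (exact P t) $ l = (if l \<in> cells P k then D 1 t $ l else 0)"
  by (simp only: rhs_part_index exact_carrier D_1_eq_rhs)

text \<open>F is affine in the state: the source cancels in the difference, and dt I_k L is
  Z_k.\<close>

lemma rhs_part_diff:
  assumes t: "t \<in> times P" and u: "u \<in> carrier_vec m" and v: "v \<in> carrier_vec m" and l: "l < m"
  shows "(Zmat P dt k *\<^sub>v (u - v)) $ l = dt * (rhs_part P k t u $ l - rhs_part P k t v $ l)"
proof -
  have uv: "u - v \<in> carrier_vec m" using u v by simp
  have Luv: "Lmat P *\<^sub>v (u - v) \<in> carrier_vec m" by (rule mult_mat_vec_carrier[OF Lmat_carrier uv])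
  have "(Zmat P dt k *\<^sub>v (u - v)) $ l = dt * (cell_mat P k *\<^sub>v (Lmat P *\<^sub>v (u - v))) $ l"
    unfolding Zmat_def smult_mat_mult_vec[OF mult_carrier_mat[OF cell_mat_carrier Lmat_carrier] uv]
      assoc_mult_mat_vec[OF cell_mat_carrier Lmat_carrier uv]
    using l carrier_matD[OF cell_mat_carrier] by (simp del: index_mult_mat_vec)
  also have "\<dots> = dt * (if l \<in> cells P k then (Lmat P *\<^sub>v u) $ l - (Lmat P *\<^sub>v v) $ l else 0)"
    unfolding cell_mat_mult_index[OF Luv l] unfolding mult_minus_distrib_mat_vec[OF Lmat_carrier u v]
    using l carrier_matD[OF Lmat_carrier] by (simp del: index_mult_mat_vec)
  finally show ?thesis
    using l u v t source_carrier[OF t] carrier_matD[OF Lmat_carrier]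
    by (simp add: rhs_part_index rhs_def del: index_mult_mat_vec)
qed

section \<open>Defects of the exact solution in stages and output\<close>

definition stage_rem :: real where
  "stage_rem = B (q + 2) * (\<Sum>k\<in>K. \<Sum>i<s. \<bar>cvec M $ i\<bar> ^ (q + 2)
     + (\<Sum>j<s. \<bar>Acoef M k $$ (i, j)\<bar> * \<bar>cvec M $ j\<bar> ^ (q + 1)))"

definition output_rem :: real where
  "output_rem = B (q + 2) * (\<Sum>k\<in>K. 1 + (\<Sum>j<s. \<bar>bcoef M k $ j\<bar> * \<bar>cvec M $ j\<bar> ^ (q + 1)))"

abbreviation "\<kappa> \<equiv> dt ^ (q + 1) / fact (q + 1)"

lemma B_nonneg: "1 \<le> i \<Longrightarrow> 0 \<le> B i"
  using deriv_bound[of i 0] linf_norm_nonneg[of "D i 0"] interval_times T by force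

lemma D_index_bound: "1 \<le> i \<Longrightarrow> t \<in> times P \<Longrightarrow> l < m \<Longrightarrow> \<bar>D i t $ l\<bar> \<le> B i"
  using deriv_bound[of i t] abs_index_le_linf_norm[of l "D i t"] D_carrier[of t i] by force

lemma stage_quadrature:
  assumes "k \<in> K" "i < s" "j < q"
  shows "(\<Sum>i'<s. Acoef M k $$ (i, i') * cvec M $ i' ^ j) = cvec M $ i ^ Suc j / real (Suc j)"
proof -
  have "(Acoef M k *\<^sub>v cpow M j) $ i = ((1 / real (j + 1)) \<cdot>\<^sub>v cpow M (j + 1)) $ i"
    using stage_order assms by (simp add: stage_order_def)
  then show ?thesis
    using assms unfolding mult_mat_vec_index[OF Acoef_carrier[OF assms(1)] cpow_carrier assms(2)]
    by (simp add: cpow_def)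
qed

text \<open>Taylor expansion with row i of the matrix of \<open>part l\<close> and node c_i; stage
  order removes the lower terms. The sums over parts and stages in \<open>stage_rem\<close> make the
  constant independent of i and l.\<close>

lemma stage_defect:
  assumes t: "t \<in> times P" "\<And>j. j < s \<Longrightarrow> t + cvec M $ j * dt \<in> times P"
    and i: "i < s" and l: "l < m"
  shows "\<bar>exact P (t + cvec M $ i * dt) $ l - exact P t $ l
      - dt * (\<Sum>j<s. Acoef M (part l) $$ (i, j) * D 1 (t + cvec M $ j * dt) $ l)
      - \<kappa> * (stage_lead (q + 1) (part l) i * D (q + 1) t $ l)\<bar> \<le> stage_rem * dt ^ (q + 2)"
proof -
  let ?g = "\<lambda>k i. \<bar>cvec M $ i\<bar> ^ (q + 2) + (\<Sum>j<s. \<bar>Acoef M k $$ (i, j)\<bar> * \<bar>cvec M $ j\<bar> ^ (q + 1))"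
  have g0: "0 \<le> ?g k i" for k i by (intro add_nonneg_nonneg sum_nonneg) auto
  have "?g (part l) i \<le> (\<Sum>i<s. ?g (part l) i)"
    using i g0 by (intro member_le_sum) auto
  also have "\<dots> \<le> (\<Sum>k\<in>K. \<Sum>i<s. ?g k i)"
    using part_mem[OF l] g0 by (intro member_le_sum[of "part l" K "\<lambda>k. \<Sum>i<s. ?g k i"] sum_nonneg) auto
  finally have le: "B (q + 2) * ?g (part l) i * dt ^ (q + 2) \<le> stage_rem * dt ^ (q + 2)"
    unfolding stage_rem_def using B_nonneg[of "q + 2"] dt by (intro mult_right_mono mult_left_mono) auto
  have "\<bar>D 0 (t + cvec M $ i * dt) $ l - D 0 t $ l
      - dt * (\<Sum>j<s. Acoef M (part l) $$ (i, j) * D 1 (t + cvec M $ j * dt) $ l)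
      - \<kappa> * ((cvec M $ i ^ (q + 1) - real (q + 1) * (\<Sum>j<s. Acoef M (part l) $$ (i, j) * cvec M $ j ^ q))
          * D (q + 1) t $ l)\<bar>
    \<le> B (q + 2) * ?g (part l) i * dt ^ (q + 2)"
    using dt t i l stage_quadrature[OF part_mem(1)[OF l] i]
    by (intro taylor_defect[OF convex_times, where f = "\<lambda>i t. D i t $ l"] D_deriv D_index_bound) auto
  then show ?thesis
    using le t i by (simp add: D_0 stage_lead_def)
qed

lemma output_defect:
  assumes t: "t \<in> times P" "\<And>j. j < s \<Longrightarrow> t + cvec M $ j * dt \<in> times P" "t + dt \<in> times P"
    and l: "l < m"
  shows "\<bar>exact P (t + dt) $ l - exact P t $ l
      - dt * (\<Sum>j<s. bcoef M (part l) $ j * D 1 (t + cvec M $ j * dt) $ l)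
      - \<kappa> * (output_lead (q + 1) (part l) * D (q + 1) t $ l)\<bar> \<le> output_rem * dt ^ (q + 2)"
proof -
  let ?g = "\<lambda>k. 1 + (\<Sum>j<s. \<bar>bcoef M k $ j\<bar> * \<bar>cvec M $ j\<bar> ^ (q + 1))"
  have g0: "0 \<le> ?g k" for k by (intro add_nonneg_nonneg sum_nonneg) auto
  have "?g (part l) \<le> (\<Sum>k\<in>K. ?g k)"
    using part_mem[OF l] g0 by (intro member_le_sum[of "part l" K ?g]) auto
  then have le: "B (q + 2) * ?g (part l) * dt ^ (q + 2) \<le> output_rem * dt ^ (q + 2)"
    unfolding output_rem_def using B_nonneg[of "q + 2"] dt by (intro mult_right_mono mult_left_mono) auto
  \<comment> \<open>The factor 1 and the powers of 1 are spelled out to match the general expansion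
    with \<gamma> = 1.\<close>
  have "\<bar>D 0 (t + 1 * dt) $ l - D 0 t $ l
      - dt * (\<Sum>j<s. bcoef M (part l) $ j * D 1 (t + cvec M $ j * dt) $ l)
      - \<kappa> * ((1 ^ (q + 1) - real (q + 1) * (\<Sum>j<s. bcoef M (part l) $ j * cvec M $ j ^ q))
          * D (q + 1) t $ l)\<bar>
    \<le> B (q + 2) * (\<bar>1\<bar> ^ (q + 2) + (\<Sum>j<s. \<bar>bcoef M (part l) $ j\<bar> * \<bar>cvec M $ j\<bar> ^ (q + 1))) * dt ^ (q + 2)"
    using dt t l quadrature[OF part_mem(1)[OF l]]
    by (intro taylor_defect[OF convex_times, where f = "\<lambda>i t. D i t $ l"] D_deriv D_index_bound) auto
  then show ?thesis
    using le t by (simp add: D_0 output_lead_def)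
qed

text \<open>Mean value estimate. For the derivative of order q + 1 it is the source of the extra
  power of dt in the increments of \<xi>.\<close>

lemma D_increment:
  assumes t: "t \<in> times P" "t + dt \<in> times P" and i: "1 \<le> i"
  shows "linf_norm (D i (t + dt) - D i t) \<le> B (Suc i) * dt"
proof (rule linf_norm_leI)
  show "0 \<le> B (Suc i) * dt" using B_nonneg[of "Suc i"] dt by simp
  fix l assume "l < dim_vec (D i (t + dt) - D i t)"
  then have l: "l < m" using carrier_vecD[OF D_carrier[OF t(1)]] by simp
  have "norm (D i (t + dt) $ l - D i t $ l) \<le> B (Suc i) * norm (t + dt - t)"
    using D_deriv[OF _ l] D_index_bound[OF _ _ l, of "Suc i"] t
    by (intro field_differentiable_bound[OF convex_times, where f' = "\<lambda>t. D (Suc i) t $ l"]) auto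
  then show "\<bar>(D i (t + dt) - D i t) $ l\<bar> \<le> B (Suc i) * dt"
    using l dt D_carrier[OF t(1), of i] D_carrier[OF t(2), of i] by simp
qed

end

section \<open>The error recursion\<close>

locale split_error_problem = cell_split_problem +
  fixes W :: "real mat" and CW KS :: real
  assumes W_carrier [simp]: "W \<in> carrier_mat m m"
    and W_eq: "(rT M m (Zmat P dt) * kron_col m (evec M)) * W
      = mat_sum m m (\<lambda>k. dmat M m (Zmat P dt) (q + 1) k * cell_mat P k) K"
    and W_norm: "linf_opnorm W \<le> CW"
    and stability: "\<And>n. linf_opnorm (Rmat M m (Zmat P dt) ^\<^sub>m n) \<le> KS"
begin

abbreviation "RT \<equiv> rT M m (Zmat P dt)"
abbreviation "ecol \<equiv> kron_col m (evec M)"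

lemma ecol_carrier [simp]: "ecol \<in> carrier_mat (m * s) m"
  by (intro kron_col_carrier) simp

text \<open>The condition on W, applied to a vector. In every component, of the output as well as of
  each stage block, the projections I_k select the coefficients of the part in charge, so the
  right-hand side has the form of the leading defects of the method.\<close>

lemma leading_defect:
  assumes x: "x \<in> carrier_vec m"
  shows "RT *\<^sub>v (ecol *\<^sub>v (W *\<^sub>v x)) = vec m (\<lambda>l. output_lead (q + 1) (part l) * x $ l)
    + RT *\<^sub>v stack m s (\<lambda>i. vec m (\<lambda>l. stage_lead (q + 1) (part l) i * x $ l))"
proof -
  define S where "S k = stack m s (\<lambda>i. vec m (\<lambda>l. stage_lead (q + 1) k i * (cell_mat P k *\<^sub>v x) $ l))" for k
  have S: "S k \<in> carrier_vec (m * s)" for k by (simp add: S_def)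
  have cx: "cell_mat P k *\<^sub>v x \<in> carrier_vec m" for k by (rule mult_mat_vec_carrier[OF cell_mat_carrier x])
  have "RT *\<^sub>v (ecol *\<^sub>v (W *\<^sub>v x)) = ((RT * ecol) * W) *\<^sub>v x"
    unfolding assoc_mult_mat_vec[OF mult_carrier_mat[OF rT_carrier ecol_carrier] W_carrier x]
      assoc_mult_mat_vec[OF rT_carrier ecol_carrier mult_mat_vec_carrier[OF W_carrier x]] ..
  also have "\<dots> = vsum m (\<lambda>k. (dmat M m (Zmat P dt) (q + 1) k * cell_mat P k) *\<^sub>v x) K"
    unfolding W_eq by (rule mat_sum_mult_vec[OF mult_carrier_mat[OF dmat_carrier cell_mat_carrier] x])
  also have "\<dots> = vsum m (\<lambda>k. vec m (\<lambda>l. output_lead (q + 1) k * (cell_mat P k *\<^sub>v x) $ l) + RT *\<^sub>v S k) K"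
  proof -
    have "(dmat M m (Zmat P dt) (q + 1) k * cell_mat P k) *\<^sub>v x
        = vec m (\<lambda>l. output_lead (q + 1) k * (cell_mat P k *\<^sub>v x) $ l) + RT *\<^sub>v S k" if "k \<in> K" for k
      unfolding assoc_mult_mat_vec[OF dmat_carrier[OF that] cell_mat_carrier x]
        dmat_mult_vec[OF that cx] S_def ..
    then show ?thesis by (simp add: vsum_def del: index_mult_mat_vec)
  qed
  also have "\<dots> = vec m (\<lambda>l. output_lead (q + 1) (part l) * x $ l) + vsum m (\<lambda>k. RT *\<^sub>v S k) K"
    using carrier_matD[OF rT_carrier]
    by (intro eq_vecI) (auto simp: vsum_def sum.distrib cell_mat_mult_index[OF x] sum_cells
        simp del: index_mult_mat_vec One_nat_def)
  also have "vsum m (\<lambda>k. RT *\<^sub>v S k) K = RT *\<^sub>v vsum (m * s) S K"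
    by (rule mult_mat_vsum[OF rT_carrier S, symmetric])
  also have "vsum (m * s) S K = stack m s (\<lambda>i. vec m (\<lambda>l. stage_lead (q + 1) (part l) i * x $ l))"
    by (rule eq_vecI) (auto simp: vsum_def S_def stack_def div_mod_less cell_mat_mult_index[OF x] sum_cells
        simp del: index_mult_mat_vec One_nat_def)
  finally show ?thesis .
qed

definition step_rem :: real where
  "step_rem = output_const * (1 + stage_const) ^ s * stage_rem + output_rem"

text \<open>Subtracting the scheme from the exact solution inserted into it gives a linear system
  for the stage errors E, with the error e and the stage defects on the right. Applying
  \<open>rT\<close> to this right-hand side replaces the stage term of the output, and e together
  with its contribution through \<open>ecol\<close> makes up R e.\<close>

lemma error_step:
  assumes t: "t \<in> times P" "\<And>j. j < s \<Longrightarrow> t + cvec M $ j * dt \<in> times P" "t + dt \<in> times P"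
    and step: "prk_step M m (rhs_part P) t dt w V w'"
  obtains \<eta> where "\<eta> \<in> carrier_vec m" "linf_norm \<eta> \<le> step_rem * dt ^ (q + 2)"
    "exact P (t + dt) - w' = Rmat M m (Zmat P dt) *\<^sub>v (exact P t - w)
      + RT *\<^sub>v (ecol *\<^sub>v (\<kappa> \<cdot>\<^sub>v (W *\<^sub>v D (q + 1) t))) + \<eta>"
proof -
  define \<tau> where "\<tau> j = t + cvec M $ j * dt" for j
  have \<tau>: "\<tau> j \<in> times P" if "j < s" for j using t(2) that by (simp add: \<tau>_def)
  define x where "x = D (q + 1) t"
  have x: "x \<in> carrier_vec m" unfolding x_def by (rule D_carrier[OF t(1)])
  have w: "w \<in> carrier_vec m" "w' \<in> carrier_vec m" and V: "\<And>j. j < s \<Longrightarrow> V j \<in> carrier_vec m"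
    using step by (auto simp: prk_step_def)
  define e where "e = exact P t - w"
  have e: "e \<in> carrier_vec m" using w exact_carrier[OF t(1)] by (simp add: e_def)
  define E where "E j = exact P (\<tau> j) - V j" for j
  have E: "E j \<in> carrier_vec m" if "j < s" for j
    using that V exact_carrier[OF \<tau>] by (simp add: E_def)
  \<comment> \<open>The leading parts (suffix 0) are kept apart from the remainders \<rho> and
    \<sigma>, because only the former are matched by W.\<close>
  define \<rho>0 where "\<rho>0 i = vec m (\<lambda>l. stage_lead (q + 1) (part l) i * x $ l)" for i
  define \<rho> where "\<rho> i = vec m (\<lambda>l. exact P (\<tau> i) $ l - exact P t $ l
      - dt * (\<Sum>j<s. Acoef M (part l) $$ (i, j) * D 1 (\<tau> j) $ l) - \<kappa> * \<rho>0 i $ l)" for i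
  define \<sigma>0 where "\<sigma>0 = vec m (\<lambda>l. output_lead (q + 1) (part l) * x $ l)"
  define \<sigma> where "\<sigma> = vec m (\<lambda>l. exact P (t + dt) $ l - exact P t $ l
      - dt * (\<Sum>j<s. bcoef M (part l) $ j * D 1 (\<tau> j) $ l) - \<kappa> * \<sigma>0 $ l)"
  have \<rho>_carrier: "\<rho> i \<in> carrier_vec m" and \<sigma>_carrier: "\<sigma> \<in> carrier_vec m" for i
    by (simp_all add: \<rho>_def \<sigma>_def)
  \<comment> \<open>Common to stages and output, with g the entries of A_k or b_k: dt times a
    numerical value of F_k is dt times the exact one minus Z_k E, and the exact ones collapse to the
    part in charge.\<close>
  have diff: "dt * (\<Sum>k\<in>K. \<Sum>j<s. g k j * rhs_part P k (\<tau> j) (V j) $ l)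
      = dt * (\<Sum>j<s. g (part l) j * D 1 (\<tau> j) $ l) - (\<Sum>k\<in>K. \<Sum>j<s. g k j * (Zmat P dt k *\<^sub>v E j) $ l)"
    if l: "l < m" for g :: "nat \<Rightarrow> nat \<Rightarrow> real" and l
  proof -
    have "(\<Sum>k\<in>K. \<Sum>j<s. g k j * (Zmat P dt k *\<^sub>v E j) $ l)
        = (\<Sum>k\<in>K. \<Sum>j<s. g k j * (dt * (D 1 (\<tau> j) $ l * (if l \<in> cells P k then 1 else 0)
            - rhs_part P k (\<tau> j) (V j) $ l)))"
    proof (intro sum.cong refl)
      fix k j assume "j \<in> {..<s}"
      then have j: "j < s" by simp
      show "g k j * (Zmat P dt k *\<^sub>v E j) $ l = g k j * (dt * (D 1 (\<tau> j) $ l * (if l \<in> cells P k then 1 else 0)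
            - rhs_part P k (\<tau> j) (V j) $ l))"
        unfolding E_def rhs_part_diff[OF \<tau>[OF j] exact_carrier[OF \<tau>[OF j]] V[OF j] l]
          rhs_part_exact[OF \<tau>[OF j] l] by simp
    qed
    also have "\<dots> = dt * (\<Sum>k\<in>K. (\<Sum>j<s. g k j * D 1 (\<tau> j) $ l) * (if l \<in> cells P k then 1 else 0))
        - dt * (\<Sum>k\<in>K. \<Sum>j<s. g k j * rhs_part P k (\<tau> j) (V j) $ l)"
      unfolding sum_distrib_left sum_distrib_right sum_subtractf[symmetric]
      by (intro sum.cong refl) (simp add: algebra_simps)
    also have "(\<Sum>k\<in>K. (\<Sum>j<s. g k j * D 1 (\<tau> j) $ l) * (if l \<in> cells P k then 1 else 0))
        = (\<Sum>j<s. g (part l) j * D 1 (\<tau> j) $ l)"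
      using sum_cells[OF l, of "\<lambda>k. \<Sum>j<s. g k j * D 1 (\<tau> j) $ l" 1] by simp
    finally show ?thesis by simp
  qed
  have E_index: "E i $ l = e $ l + (\<Sum>k\<in>K. \<Sum>j<s. Acoef M k $$ (i, j) * (Zmat P dt k *\<^sub>v E j) $ l)
      + (\<kappa> * \<rho>0 i $ l + \<rho> i $ l)" if "i < s" "l < m" for i l
  proof -
    have "V i $ l = w $ l + dt * (\<Sum>k\<in>K. \<Sum>j<s. Acoef M k $$ (i, j) * rhs_part P k (\<tau> j) (V j) $ l)"
      using step that by (simp add: prk_step_def \<tau>_def)
    then show ?thesis
      using that w V[OF that(1)] diff[OF that(2), of "\<lambda>k j. Acoef M k $$ (i, j)"]
      by (simp add: \<rho>_def E_def e_def del: index_mult_mat_vec)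
  qed
  have e'_index: "(exact P (t + dt) - w') $ l = e $ l + (output_mat *\<^sub>v stack m s E) $ l + (\<kappa> * \<sigma>0 $ l + \<sigma> $ l)"
    if "l < m" for l
  proof -
    have "w' $ l = w $ l + dt * (\<Sum>k\<in>K. \<Sum>j<s. bcoef M k $ j * rhs_part P k (\<tau> j) (V j) $ l)"
      using step that by (simp add: prk_step_def \<tau>_def)
    then show ?thesis
      using that w diff[OF that, of "\<lambda>k j. bcoef M k $ j"]
      by (simp add: \<sigma>_def e_def output_mat_stack[OF E] del: index_mult_mat_vec)
  qed
  have ecol_e: "ecol *\<^sub>v e \<in> carrier_vec (m * s)" by (rule mult_mat_vec_carrier[OF ecol_carrier e])
  define r0 where "r0 = stack m s \<rho>0"
  define r where "r = stack m s \<rho>"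
  have r: "r0 \<in> carrier_vec (m * s)" "r \<in> carrier_vec (m * s)" by (simp_all add: r0_def r_def)
  have stage_E: "stage_mat *\<^sub>v stack m s E
      = stack m s (\<lambda>i. vec m (\<lambda>l. \<Sum>k\<in>K. \<Sum>j<s. Acoef M k $$ (i, j) * (Zmat P dt k *\<^sub>v E j) $ l))"
    by (rule stage_mat_stack) (rule E)
  \<comment> \<open>The stage error system: copies of e, leading defects and remainders on the
    right.\<close>
  have "stack m s E - stage_mat *\<^sub>v stack m s E = ecol *\<^sub>v e + (\<kappa> \<cdot>\<^sub>v r0 + r)"
    unfolding stage_E kron_col_mult_vec[OF evec_carrier e] r0_def r_def
    using e E_index by (intro eq_vecI)
      (auto simp: stack_def div_mod_less evec_def \<rho>0_def \<rho>_carrier[THEN carrier_vecD] simp del: index_mult_mat_vec)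
  then have "output_mat *\<^sub>v stack m s E = RT *\<^sub>v (ecol *\<^sub>v e + (\<kappa> \<cdot>\<^sub>v r0 + r))"
    using rT_mult_vec[OF stack_carrier, of E] by simp
  also have "\<dots> = RT *\<^sub>v (ecol *\<^sub>v e) + (\<kappa> \<cdot>\<^sub>v (RT *\<^sub>v r0) + RT *\<^sub>v r)"
    using r by (simp only: mult_add_distrib_mat_vec[OF rT_carrier] mult_mat_vec[OF rT_carrier]
        ecol_e smult_carrier_vec add_carrier_vec)
  finally have out: "output_mat *\<^sub>v stack m s E = RT *\<^sub>v (ecol *\<^sub>v e) + (\<kappa> \<cdot>\<^sub>v (RT *\<^sub>v r0) + RT *\<^sub>v r)" .
  \<comment> \<open>Leading defects of output and stages together form the image of \<kappa> W x
    under R - I.\<close>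
  have lead: "RT *\<^sub>v (ecol *\<^sub>v (\<kappa> \<cdot>\<^sub>v (W *\<^sub>v x))) = \<kappa> \<cdot>\<^sub>v (\<sigma>0 + RT *\<^sub>v r0)"
    using leading_defect[OF x] mult_mat_vec[OF ecol_carrier mult_mat_vec_carrier[OF W_carrier x], of \<kappa>]
      mult_mat_vec[OF rT_carrier mult_mat_vec_carrier[OF ecol_carrier mult_mat_vec_carrier[OF W_carrier x]], of \<kappa>]
    by (simp add: \<sigma>0_def r0_def \<rho>0_def[abs_def])
  have "exact P (t + dt) - w' = Rmat M m (Zmat P dt) *\<^sub>v e
      + RT *\<^sub>v (ecol *\<^sub>v (\<kappa> \<cdot>\<^sub>v (W *\<^sub>v x))) + (RT *\<^sub>v r + \<sigma>)"
    (is "_ = ?rhs")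
  proof (rule eq_vecI)
    have dims: "dim_vec e = m" "dim_vec \<sigma> = m" "dim_vec \<sigma>0 = m" "dim_row RT = m"
      using e \<sigma>_carrier carrier_matD[OF rT_carrier] by (simp_all add: \<sigma>0_def)
    show "dim_vec (exact P (t + dt) - w') = dim_vec ?rhs" using w dims by simp
    fix l assume "l < dim_vec ?rhs"
    then have l: "l < m" using dims by simp
    show "(exact P (t + dt) - w') $ l = ?rhs $ l"
      unfolding e'_index[OF l] out lead Rmat_mult_vec[OF e]
      using l dims by (simp add: distrib_left del: index_mult_mat_vec power_Suc fact_Suc)
  qed
  moreover have "linf_norm (RT *\<^sub>v r + \<sigma>) \<le> step_rem * dt ^ (q + 2)"
  proof -
    have B0: "0 \<le> stage_rem" "0 \<le> output_rem" unfolding stage_rem_def output_rem_def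
      using B_nonneg[of "q + 2"] by (auto intro!: mult_nonneg_nonneg sum_nonneg add_nonneg_nonneg)
    have "\<bar>\<rho> i $ l\<bar> \<le> stage_rem * dt ^ (q + 2)" if "i < s" "l < m" for i l
      using stage_defect[OF t(1,2) that] that by (simp add: \<rho>_def \<rho>0_def \<tau>_def x_def)
    then have "linf_norm r \<le> stage_rem * dt ^ (q + 2)" unfolding r_def
      using B0 dt \<rho>_carrier
      by (intro linf_norm_stack_le linf_norm_leI) (auto simp: carrier_vecD[OF \<rho>_carrier])
    then have "output_const * (1 + stage_const) ^ s * linf_norm r
        \<le> output_const * (1 + stage_const) ^ s * (stage_rem * dt ^ (q + 2))"
      using output_const_nonneg stage_const_nonneg by (intro mult_left_mono) auto
    then have "linf_norm (RT *\<^sub>v r) \<le> output_const * (1 + stage_const) ^ s * (stage_rem * dt ^ (q + 2))"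
      using rT_norm[OF r(2)] by linarith
    moreover have "linf_norm \<sigma> \<le> output_rem * dt ^ (q + 2)"
    proof (rule linf_norm_leI)
      show "0 \<le> output_rem * dt ^ (q + 2)" using B0 dt by simp
      fix l assume "l < dim_vec \<sigma>"
      then have "l < m" by (simp add: \<sigma>_def)
      then show "\<bar>\<sigma> $ l\<bar> \<le> output_rem * dt ^ (q + 2)"
        using output_defect[OF t] by (simp add: \<sigma>_def \<sigma>0_def \<tau>_def x_def)
    qed
    moreover have "linf_norm (RT *\<^sub>v r + \<sigma>) \<le> linf_norm (RT *\<^sub>v r) + linf_norm \<sigma>"
      by (intro linf_norm_triangle[OF mult_mat_vec_carrier[OF rT_carrier r(2)] \<sigma>_carrier])
    ultimately show ?thesis by (simp add: step_rem_def algebra_simps)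
  qed
  moreover have "RT *\<^sub>v r + \<sigma> \<in> carrier_vec m"
    by (intro add_carrier_vec mult_mat_vec_carrier[OF rT_carrier r(2)] \<sigma>_carrier)
  ultimately show ?thesis using that unfolding x_def e_def by blast
qed

section \<open>Summation of the errors\<close>

definition err_const :: real where
  "err_const = (KS + 1) * (CW * B (q + 1)) + T * (KS * (CW * B (q + 2) + step_rem))"

lemma step_rem_nonneg: "0 \<le> step_rem"
  unfolding step_rem_def stage_rem_def output_rem_def
  using B_nonneg[of "q + 2"] output_const_nonneg stage_const_nonneg
  by (auto intro!: mult_nonneg_nonneg sum_nonneg add_nonneg_nonneg)

lemma KS_nonneg: "0 \<le> KS" and CW_nonneg: "0 \<le> CW"
  using stability[of 0] W_norm linf_opnorm_nonneg order_trans by blast+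

lemma W_smult_norm:
  assumes "x \<in> carrier_vec m"
  shows "linf_norm (\<kappa> \<cdot>\<^sub>v (W *\<^sub>v x)) \<le> CW * linf_norm x * dt ^ (q + 1)"
proof -
  have "linf_norm (W *\<^sub>v x) \<le> CW * linf_norm x" by (rule linf_norm_mult_mat_vec_le[OF W_carrier assms W_norm])
  moreover have "\<bar>\<kappa>\<bar> \<le> dt ^ (q + 1)"
    using dt mult_left_mono[OF fact_ge_1[of "q + 1"], of "dt ^ (q + 1)"]
    by (simp add: divide_le_eq del: fact_Suc power_Suc)
  ultimately have "\<bar>\<kappa>\<bar> * linf_norm (W *\<^sub>v x) \<le> dt ^ (q + 1) * (CW * linf_norm x)"
    using linf_norm_nonneg dt by (intro mult_mono) auto
  then show ?thesis using linf_norm_smult[of \<kappa> "W *\<^sub>v x"] by (simp add: mult.commute)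
qed

lemma global_error:
  assumes num: "numerical_solution M P T dt w" and N: "real N * dt \<le> T"
  shows "linf_norm (exact P (real N * dt) - w N) \<le> err_const * dt ^ (q + 1)"
proof -
  define R where "R = Rmat M m (Zmat P dt)"
  have R: "R \<in> carrier_mat m m" by (simp add: R_def)
  have le_T: "real n * dt \<le> T" if "n \<le> N" for n
    using N dt that mult_right_mono[of "real n" "real N" dt] by linarith
  have times: "real n * dt \<in> times P" if "n \<le> N" for n
    using le_T[OF that] dt interval_times by auto
  have step: "\<exists>V. prk_step M m (rhs_part P) (real n * dt) dt (w n) V (w (Suc n))" if "n < N" for n
    using num le_T[of "Suc n"] that by (simp add: numerical_solution_def)
  have w: "w n \<in> carrier_vec m" if "n \<le> N" for n
  proof (cases n)
    case 0
    then show ?thesis using num times[of 0] exact_carrier[of 0] by (simp add: numerical_solution_def)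
  next
    case (Suc n')
    then show ?thesis using step[of n'] that by (auto simp: prk_step_def)
  qed
  define x where "x n = D (q + 1) (real n * dt)" for n
  have x: "x n \<in> carrier_vec m" "linf_norm (x n) \<le> B (q + 1)" if "n \<le> N" for n
    unfolding x_def using D_carrier[OF times[OF that]] deriv_bound[OF _ times[OF that]] by auto
  define \<xi> where "\<xi> n = \<kappa> \<cdot>\<^sub>v (W *\<^sub>v x n)" for n
  have \<xi>: "\<xi> n \<in> carrier_vec m" if "n \<le> N" for n
    using mult_mat_vec_carrier[OF W_carrier x(1)[OF that]] by (simp add: \<xi>_def)
  define X where "X = CW * B (q + 1) * dt ^ (q + 1)"
  have X: "linf_norm (\<xi> n) \<le> X" if "n \<le> N" for n
  proof -
    have "CW * linf_norm (x n) * dt ^ (q + 1) \<le> X"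
      unfolding X_def using x(2)[OF that] CW_nonneg dt by (intro mult_right_mono mult_left_mono) auto
    then show ?thesis using W_smult_norm[OF x(1)[OF that]] by (simp add: \<xi>_def)
  qed
  define e where "e n = exact P (real n * dt) - w n" for n
  have e: "e n \<in> carrier_vec m" if "n \<le> N" for n
    using w[OF that] exact_carrier[OF times[OF that]] by (simp add: e_def)
  define v where "v n = e n + \<xi> n" for n
  have v: "v n \<in> carrier_vec m" if "n \<le> N" for n using e \<xi> that by (simp add: v_def)
  \<comment> \<open>As \<zeta> is defined to be the residual, the recursion holds by construction
    and only the size of \<zeta> needs an argument.\<close>
  define \<zeta> where "\<zeta> n = v (Suc n) - R *\<^sub>v v n" for n
  have \<zeta>: "\<zeta> n \<in> carrier_vec m" if "n < N" for n
    unfolding \<zeta>_def using that by (intro minus_carrier_vec mult_mat_vec_carrier[OF R] v) auto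
  define z where "z = (CW * B (q + 2) + step_rem) * dt ^ (q + 2)"
  have z: "linf_norm (\<zeta> n) \<le> z" if n: "n < N" for n
  proof -
    let ?t = "real n * dt"
    have Suc_t: "?t + dt = real (Suc n) * dt" by (simp add: algebra_simps)
    have stages: "?t + cvec M $ j * dt \<in> times P" if "j < s" for j
      using time_points le_T[of "Suc n"] n that by (simp add: time_points_in_def)
    have t: "?t \<in> times P" "?t + dt \<in> times P" using times[of n] times[of "Suc n"] n by (auto simp: Suc_t)
    obtain V where "prk_step M m (rhs_part P) ?t dt (w n) V (w (Suc n))" using step[OF n] by blast
    then obtain \<eta> where \<eta>: "\<eta> \<in> carrier_vec m" "linf_norm \<eta> \<le> step_rem * dt ^ (q + 2)"
      and eq: "e (Suc n) = R *\<^sub>v e n + RT *\<^sub>v (ecol *\<^sub>v \<xi> n) + \<eta>"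
      using error_step[OF t(1) stages t(2)] unfolding e_def R_def \<xi>_def x_def Suc_t by blast
    have \<xi>n: "\<xi> n \<in> carrier_vec m" "\<xi> (Suc n) \<in> carrier_vec m" and en: "e n \<in> carrier_vec m"
      and xn: "x n \<in> carrier_vec m" "x (Suc n) \<in> carrier_vec m"
      using \<xi> e x(1) n by auto
    have car: "RT *\<^sub>v (ecol *\<^sub>v \<xi> n) \<in> carrier_vec m" "R *\<^sub>v e n \<in> carrier_vec m"
      by (intro mult_mat_vec_carrier[OF rT_carrier] mult_mat_vec_carrier[OF ecol_carrier]
          mult_mat_vec_carrier[OF R] \<xi>n en)+
    have "R *\<^sub>v v n = R *\<^sub>v e n + (\<xi> n + RT *\<^sub>v (ecol *\<^sub>v \<xi> n))"
      unfolding v_def mult_add_distrib_mat_vec[OF R en \<xi>n(1)]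
      unfolding R_def Rmat_mult_vec[OF \<xi>n(1)] ..
    \<comment> \<open>Here b stands for (R - I) \<xi>_n: it enters once with the local error and
      once with R v_n, and cancels.\<close>
    moreover have "(a + b + \<eta>) + d - (a + (c + b)) = (d - c) + \<eta>"
      if "dim_vec a = m" "dim_vec b = m" "dim_vec c = m" "dim_vec d = m" for a b c d
      using that carrier_vecD[OF \<eta>(1)] by (intro eq_vecI) simp_all
    ultimately have \<zeta>_eq: "\<zeta> n = (\<xi> (Suc n) - \<xi> n) + \<eta>"
      unfolding \<zeta>_def v_def[of "Suc n"] eq using car[THEN carrier_vecD] \<xi>n[THEN carrier_vecD]
      by (simp only:)
    have \<xi>_diff: "\<xi> (Suc n) - \<xi> n = \<kappa> \<cdot>\<^sub>v (W *\<^sub>v (x (Suc n) - x n))"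
      unfolding \<xi>_def mult_minus_distrib_mat_vec[OF W_carrier xn(2,1)]
      using carrier_matD[OF W_carrier]
      by (intro eq_vecI) (auto simp: right_diff_distrib simp del: index_mult_mat_vec fact_Suc power_Suc)
    have "linf_norm (\<xi> (Suc n) - \<xi> n) \<le> CW * (B (q + 2) * dt) * dt ^ (q + 1)"
    proof -
      have "linf_norm (x (Suc n) - x n) \<le> B (q + 2) * dt"
        using D_increment[OF t, of "q + 1"] by (simp add: x_def Suc_t del: of_nat_Suc)
      then have "CW * linf_norm (x (Suc n) - x n) * dt ^ (q + 1) \<le> CW * (B (q + 2) * dt) * dt ^ (q + 1)"
        using CW_nonneg dt by (intro mult_right_mono mult_left_mono) auto
      then show ?thesis
        unfolding \<xi>_diff using W_smult_norm[OF minus_carrier_vec[OF xn(2,1)]] by linarith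
    qed
    then have "linf_norm (\<zeta> n) \<le> CW * (B (q + 2) * dt) * dt ^ (q + 1) + step_rem * dt ^ (q + 2)"
      unfolding \<zeta>_eq using linf_norm_triangle[OF minus_carrier_vec[OF \<xi>n(2,1)] \<eta>(1)] \<eta>(2) by linarith
    then show ?thesis by (simp add: z_def algebra_simps)
  qed
  have vstep: "v (Suc n) = R *\<^sub>v v n + \<zeta> n" if "n < N" for n
    unfolding \<zeta>_def using carrier_matD[OF R] v[of "Suc n"] mult_mat_vec_carrier[OF R v, of n] that
    by (intro eq_vecI) (auto simp del: index_mult_mat_vec)
  have "linf_norm (R ^\<^sub>m 0 *\<^sub>v v N) \<le> KS * linf_norm (v 0) + real N * (KS * z)"
    using stability
    by (intro perturbed_power_bound[where N = N and \<zeta> = \<zeta> and m = m] R v \<zeta> z vstep order_refl)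
      (auto simp: R_def)
  then have vN: "linf_norm (v N) \<le> KS * linf_norm (v 0) + real N * (KS * z)"
    using carrier_matD[OF R] v[of N] by simp
  have "exact P 0 \<in> carrier_vec m" using times[of 0] by (simp add: exact_carrier)
  \<comment> \<open>The method starts on the exact solution, so the shifted error starts as the
    shift alone.\<close>
  then have "v 0 = \<xi> 0" using num \<xi>[of 0] by (auto simp: v_def e_def numerical_solution_def)
  then have "KS * linf_norm (v 0) \<le> KS * X" using X[of 0] KS_nonneg by (simp add: mult_left_mono)
  moreover have "real N * (KS * z) \<le> T * (KS * (CW * B (q + 2) + step_rem)) * dt ^ (q + 1)"
  proof -
    \<comment> \<open>One of the q + 2 powers of dt in z pays for the N steps through N dt \<le>
      T.\<close>
    have "real N * (KS * z) = (real N * dt) * (KS * (CW * B (q + 2) + step_rem) * dt ^ (q + 1))"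
      by (simp add: z_def algebra_simps)
    also have "\<dots> \<le> T * (KS * (CW * B (q + 2) + step_rem) * dt ^ (q + 1))"
      using N KS_nonneg CW_nonneg B_nonneg[of "q + 2"] step_rem_nonneg dt by (intro mult_right_mono) auto
    finally show ?thesis by (simp add: mult.assoc)
  qed
  moreover have "linf_norm (e N) \<le> linf_norm (v N) + linf_norm (\<xi> N)"
  proof -
    have "e N = v N - \<xi> N" unfolding v_def using e[of N] \<xi>[of N] by (intro eq_vecI) auto
    then show ?thesis using linf_norm_diff_le[OF v \<xi>] by simp
  qed
  \<comment> \<open>The three contributions to \<open>err_const\<close>: the initial shift amplified
    by KS, the accumulated perturbations, and the removal of the shift at the end.\<close>
  ultimately have "linf_norm (e N) \<le> KS * X + T * (KS * (CW * B (q + 2) + step_rem)) * dt ^ (q + 1) + X"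
    using vN X[of N] by linarith
  also have "\<dots> = err_const * dt ^ (q + 1)" by (simp add: err_const_def X_def algebra_simps)
  finally show ?thesis by (simp add: e_def)
qed

end

theorem theorem5p1:
  fixes M :: prk and p q :: nat
    and Fam :: "(semidiscrete \<times> real) set"
    and T CZ K CW :: real and B :: "nat \<Rightarrow> real"
  assumes rk: "prk_method M" "explicit_prk M"
    and orders: "classical_order M p" "stage_order M q" "p \<ge> q + 1"
    and T: "T > 0"
    and family: "\<And>P dt. (P, dt) \<in> Fam \<Longrightarrow>
          dt > 0 \<and> semidiscrete_system (parts M) P \<and> time_points_in M T dt (times P)"
    and Z_bounded: "\<And>P dt k. (P, dt) \<in> Fam \<Longrightarrow> k \<in> {1..parts M} \<Longrightarrow>
          linf_opnorm (Zmat P dt k) \<le> CZ"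
    and smooth: "\<And>P dt. (P, dt) \<in> Fam \<Longrightarrow>
          \<exists>D. exact_derivs P D \<and> (\<forall>i\<ge>1. \<forall>t\<in>times P. linf_norm (D i t) \<le> B i)"
    and stability: "\<And>P dt n. (P, dt) \<in> Fam \<Longrightarrow>
          linf_opnorm (Rmat M (dim P) (Zmat P dt) ^\<^sub>m n) \<le> K"
    and W: "\<And>P dt. (P, dt) \<in> Fam \<Longrightarrow>
          \<exists>W\<in>carrier_mat (dim P) (dim P).
            (rT M (dim P) (Zmat P dt) * kron_col (dim P) (evec M)) * W =
              mat_sum (dim P) (dim P)
                (\<lambda>k. dmat M (dim P) (Zmat P dt) (q + 1) k * cell_mat P k) {1..parts M} \<and>
            linf_opnorm W \<le> CW"
  shows "\<exists>C. \<exists>\<delta>>0. \<forall>(P, dt)\<in>Fam. dt \<le> \<delta> \<longrightarrow>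
          (\<forall>w. numerical_solution M P T dt w \<longrightarrow>
            (\<forall>n. real n * dt \<le> T \<longrightarrow>
              linf_norm (exact P (real n * dt) - w n) \<le> C * dt ^ (q + 1)))"
proof -
  \<comment> \<open>The constant mentions the method, T, q and the uniform bounds, but neither P and
    dt nor the D and W obtained for them; this is the claimed uniformity.\<close>
  have "linf_norm (exact P (real n * dt) - w n) \<le> split_error_problem.err_const M T CZ q B CW K * dt ^ (q + 1)"
    if Fam: "(P, dt) \<in> Fam" and num: "numerical_solution M P T dt w" and n: "real n * dt \<le> T" for P dt w n
  proof -
    obtain D where D: "exact_derivs P D" "\<And>i t. 1 \<le> i \<Longrightarrow> t \<in> times P \<Longrightarrow> linf_norm (D i t) \<le> B i"
      using smooth[OF Fam] by blast
    obtain W where W: "W \<in> carrier_mat (dim P) (dim P)"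
      "(rT M (dim P) (Zmat P dt) * kron_col (dim P) (evec M)) * W =
              mat_sum (dim P) (dim P)
                (\<lambda>k. dmat M (dim P) (Zmat P dt) (q + 1) k * cell_mat P k) {1..parts M}"
      "linf_opnorm W \<le> CW"
      using W[OF Fam] by blast
    interpret cell_split_problem M P dt T CZ q D B
      using rk orders T family[OF Fam] Z_bounded[OF Fam] D quadrature_conditions[OF rk(1) orders(1)]
      by unfold_locales auto
    interpret split_error_problem M P dt T CZ q D B W CW K
      using W stability[OF Fam] by unfold_locales auto
    show ?thesis by (rule global_error[OF num n])
  qed
  \<comment> \<open>The estimate covers every step size in the family, so the threshold 1 is an
    arbitrary choice.\<close>
  then show ?thesis by (intro exI[of _ "split_error_problem.err_const M T CZ q B CW K"] exI[of _ 1]) auto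
qed

end
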